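(* Let $(\mathsf G,\mathcal G,\nu)$, $\varpi$, $c$, $\pi$, $\mathsf T$, $\mathsf G(t)$, $m$, $\nu_t$ be as in the context, let $(H_t)_{t\in\mathsf T}$ be a family of Markov kernels such that $H_t$ is a $\nu_t$-reversible Markov kernel on $\mathsf G(t)$ for each $t\in\mathsf T$, and let $U$ and $H$ be the ideal and hybrid slice sampling kernels on $\mathsf G$ defined in the context. (i) Assume that $H_t$ is positive on $\mathrm L^2(\nu_t)$ for every $t\in\mathsf T$. Then for all $f\in\mathrm L^2_0(\pi)$, $$\mathcal E_\pi(H,f)\le \mathcal E_\pi(U,f).$$ (ii) Assume moreover that $\widetilde\beta:(0,\infty)\times\mathsf T\to[0,1/4]$ is a measurable function such that for Lebesgue-almost every $t\in\mathsf T$ the kernel $H_t$ satisfies a weak Poincaré inequality with respect to $\widetilde\beta(\cdot,t)$ (on $\mathsf G(t)$ with measure $\nu_t$). Define $\beta:(0,\infty)\to[0,\infty)$ by $$\beta(s):=c^{-1}\int_{\mathsf T}\widetilde\beta(s,t)\,m(t)\,\mathrm dt .$$ Then $\beta$ is decreasing, $\lim_{s\to\infty}\beta(s)=0$, and for all $s>0$ and $f\in\mathrm L^2_0(\pi)$, $$\mathcal E_\pi(U,f)\le s\cdot\mathcal E_\pi(H,f)+\beta(s)\cdot\|f\|_{\mathrm{osc},\pi}^2 .$$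
   Context: Setting: $(\mathsf G,\mathcal G,\nu)$ is a $\sigma$-finite measure space; $\varpi:\mathsf G\to(0,\infty)$ is measurable with $c:=\int_{\mathsf G}\varpi\,\mathrm d\nu\in(0,\infty)$; $\pi(\mathrm dx)=c^{-1}\varpi(x)\,\nu(\mathrm dx)$ is a probability measure. It is assumed that the supremum $\|\varpi\|_\infty$ (possibly $+\infty$) equals the $\nu$-essential supremum of $\varpi$. Let $\mathsf T:=(0,\|\varpi\|_\infty)$ and, for $t\in\mathsf T$, $\mathsf G(t):=\{x\in\mathsf G:\varpi(x)>t\}$, $m(t):=\nu(\mathsf G(t))$, $\nu_t(A):=\nu(A\cap\mathsf G(t))/m(t)$ for $A\in\mathcal G$. Ideal slice sampling kernel: $U(x,A)=\frac1{\varpi(x)}\int_0^{\varpi(x)}\nu_t(A)\,\mathrm dt$. Hybrid slice sampling kernel: $H(x,A)=\frac1{\varpi(x)}\int_0^{\varpi(x)}H_t(x,A\cap\mathsf G(t))\,\mathrm dt$, for $x\in\mathsf G$, $A\in\mathcal G$, where the family $(H_t)$ is assumed to depend measurably on $t$ so that $H$ is a well-defined Markov kernel. For a probability measure $\mu$: $\mathrm L^2(\mu)$ is the space of square-integrable functions with inner product $\langle f,g\rangle_\mu=\mu(fg)$ and norm $\|\cdot\|_\mu$; $\mathrm L^2_0(\mu)=\{f\in\mathrm L^2(\mu):\mu(f)=0\}$; $\|f\|_{\mathrm{osc},\mu}:=\operatorname{ess\,sup}_\mu f-\operatorname{ess\,inf}_\mu f\in[0,\infty]$, with the convention $0\cdot\infty=0$.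 A Markov kernel $P$ is $\mu$-reversible if $\mu(\mathrm dx)P(x,\mathrm dy)$ is a symmetric measure; it acts by $\mathrm Pf(x)=\int f(y)P(x,\mathrm dy)$; it is positive if $\langle \mathrm Pf,f\rangle_\mu\ge0$ for all $f\in \mathrm L^2(\mu)$. For $\mu$-reversible $P$ the Dirichlet form is $\mathcal E_\mu(P,f)=\langle(\mathrm{Id}-\mathrm P)f,f\rangle_\mu=\frac12\iint[f(x)-f(y)]^2P(x,\mathrm dy)\mu(\mathrm dx)$. Weak Poincaré inequality (WPI): a Markov kernel $P$ satisfies a WPI with respect to $b:(0,\infty)\to[0,\infty)$ (and the probability measure $\mu$) if $b$ is decreasing (in the non-strict sense) with $\lim_{s\to\infty}b(s)=0$, $P$ is $\mu$-reversible and positive, and $\|f\|_\mu^2\le s\cdot\mathcal E_\mu(P,f)+b(s)\cdot\|f\|_{\mathrm{osc},\mu}^2$ for all $s>0$ and $f\in\mathrm L^2_0(\mu)$. *)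

theory Defs
  imports "HOL-Probability.Probability"
begin

text \<open>
  Elements of \<open>L\<^sup>2(\<mu>)\<close> are represented by functions instead of equivalence classes.
  The measure \<open>\<mu>\<close> is a probability measure wherever these definitions are used, so a
  square-integrable function is integrable.
\<close>

definition L2 :: "'a measure \<Rightarrow> ('a \<Rightarrow> real) set" where
  "L2 \<mu> = {f \<in> borel_measurable \<mu>. integrable \<mu> (\<lambda>x. (f x)\<^sup>2)}"

definition L2_0 :: "'a measure \<Rightarrow> ('a \<Rightarrow> real) set" where
  "L2_0 \<mu> = {f \<in> L2 \<mu>. (\<integral>x. f x \<partial>\<mu>) = 0}"

definition L2_inner :: "'a measure \<Rightarrow> ('a \<Rightarrow> real) \<Rightarrow> ('a \<Rightarrow> real) \<Rightarrow> real" where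
  "L2_inner \<mu> f g = (\<integral>x. f x * g x \<partial>\<mu>)"

definition essinf :: "'a measure \<Rightarrow> ('a \<Rightarrow> ereal) \<Rightarrow> ereal" where
  "essinf \<mu> f = - esssup \<mu> (\<lambda>x. - f x)"

definition osc_norm :: "'a measure \<Rightarrow> ('a \<Rightarrow> real) \<Rightarrow> ereal" where
  "osc_norm \<mu> f = esssup \<mu> (\<lambda>x. ereal (f x)) - essinf \<mu> (\<lambda>x. ereal (f x))"

definition markov_kernel :: "'a measure \<Rightarrow> ('a \<Rightarrow> 'a measure) \<Rightarrow> bool" where
  "markov_kernel M P \<longleftrightarrow> P \<in> M \<rightarrow>\<^sub>M prob_algebra M"

text \<open>The measure \<open>\<mu>(dx) P(x, dy)\<close> on the product space.\<close>

definition joint_measure ::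
    "'a measure \<Rightarrow> ('a \<Rightarrow> 'a measure) \<Rightarrow> ('a \<times> 'a) measure" where
  "joint_measure \<mu> P = \<mu> \<bind> (\<lambda>x. P x \<bind> (\<lambda>y. return (\<mu> \<Otimes>\<^sub>M \<mu>) (x, y)))"

definition reversible :: "'a measure \<Rightarrow> ('a \<Rightarrow> 'a measure) \<Rightarrow> bool" where
  "reversible \<mu> P \<longleftrightarrow> markov_kernel \<mu> P \<and>
     distr (joint_measure \<mu> P) (\<mu> \<Otimes>\<^sub>M \<mu>) prod.swap = joint_measure \<mu> P"

text \<open>
  For \<open>f\<close> in \<open>L\<^sup>2(\<mu>)\<close> and a \<open>\<mu>\<close>-reversible \<open>P\<close>, the function \<open>f\<close> is
  \<open>P x\<close>-integrable for \<open>\<mu>\<close>-almost all \<open>x\<close>; on the exceptional null set the Bochner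
  integral is \<open>0\<close> by convention, which does not affect the notions below.
\<close>

definition kernel_op :: "('a \<Rightarrow> 'a measure) \<Rightarrow> ('a \<Rightarrow> real) \<Rightarrow> 'a \<Rightarrow> real" where
  "kernel_op P f x = (\<integral>y. f y \<partial>P x)"

definition positive_kernel :: "'a measure \<Rightarrow> ('a \<Rightarrow> 'a measure) \<Rightarrow> bool" where
  "positive_kernel \<mu> P \<longleftrightarrow> (\<forall>f \<in> L2 \<mu>. 0 \<le> L2_inner \<mu> (kernel_op P f) f)"

definition dirichlet_form ::
    "'a measure \<Rightarrow> ('a \<Rightarrow> 'a measure) \<Rightarrow> ('a \<Rightarrow> real) \<Rightarrow> real" where
  "dirichlet_form \<mu> P f = L2_inner \<mu> (\<lambda>x. f x - kernel_op P f x) f"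

text \<open>
  Only the values of \<open>b\<close> on \<open>(0, \<infinity>)\<close> matter. The inequality is stated in the extended
  reals since the oscillation may be infinite; there \<open>0 * \<infinity> = 0\<close>.
\<close>

definition weak_poincare ::
    "'a measure \<Rightarrow> ('a \<Rightarrow> 'a measure) \<Rightarrow> (real \<Rightarrow> real) \<Rightarrow> bool" where
  "weak_poincare \<mu> P b \<longleftrightarrow>
     (\<forall>s>0. 0 \<le> b s) \<and> antimono_on {0<..} b \<and> (b \<longlongrightarrow> 0) at_top \<and>
     reversible \<mu> P \<and> positive_kernel \<mu> P \<and>
     (\<forall>s>0. \<forall>f \<in> L2_0 \<mu>.
        ereal (L2_inner \<mu> f f)
          \<le> ereal (s * dirichlet_form \<mu> P f) + ereal (b s) * (osc_norm \<mu> f)\<^sup>2)"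


definition target_measure :: "'a measure \<Rightarrow> ('a \<Rightarrow> real) \<Rightarrow> 'a measure" where
  "target_measure \<nu> w = density \<nu> (\<lambda>x. ennreal (w x / (\<integral>y. w y \<partial>\<nu>)))"

definition levels :: "'a measure \<Rightarrow> ('a \<Rightarrow> real) \<Rightarrow> real set" where
  "levels \<nu> w = {t. 0 < t \<and> ereal t < (SUP x\<in>space \<nu>. ereal (w x))}"

definition level_set :: "'a measure \<Rightarrow> ('a \<Rightarrow> real) \<Rightarrow> real \<Rightarrow> 'a set" where
  "level_set \<nu> w t = {x \<in> space \<nu>. t < w x}"

definition level_mass :: "'a measure \<Rightarrow> ('a \<Rightarrow> real) \<Rightarrow> real \<Rightarrow> real" where
  "level_mass \<nu> w t = measure \<nu> (level_set \<nu> w t)"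

text \<open>
  The normalised restriction to a level set is needed twice: as a measure on the whole
  space (for the ideal kernel), and as a measure on the level set itself (as the
  reversing measure of the kernel on that level).
\<close>

definition level_uniform :: "'a measure \<Rightarrow> ('a \<Rightarrow> real) \<Rightarrow> real \<Rightarrow> 'a measure" where
  "level_uniform \<nu> w t = uniform_measure \<nu> (level_set \<nu> w t)"

definition level_uniform_on :: "'a measure \<Rightarrow> ('a \<Rightarrow> real) \<Rightarrow> real \<Rightarrow> 'a measure" where
  "level_uniform_on \<nu> w t = restrict_space (level_uniform \<nu> w t) (level_set \<nu> w t)"

definition ideal_slice ::
    "'a measure \<Rightarrow> ('a \<Rightarrow> real) \<Rightarrow> 'a \<Rightarrow> 'a measure" where
  "ideal_slice \<nu> w x = measure_of (space \<nu>) (sets \<nu>)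
     (\<lambda>A. (\<integral>\<^sup>+t\<in>{0<..<w x}. emeasure (level_uniform \<nu> w t) A \<partial>lborel) / ennreal (w x))"

definition hybrid_slice ::
    "'a measure \<Rightarrow> ('a \<Rightarrow> real) \<Rightarrow> (real \<Rightarrow> 'a \<Rightarrow> 'a measure) \<Rightarrow> 'a \<Rightarrow> 'a measure" where
  "hybrid_slice \<nu> w H x = measure_of (space \<nu>) (sets \<nu>)
     (\<lambda>A. (\<integral>\<^sup>+t\<in>{0<..<w x}. emeasure (H t x) (A \<inter> level_set \<nu> w t) \<partial>lborel)
           / ennreal (w x))"

text \<open>
  Joint measurability of \<open>(t, x) \<mapsto> H\<^sub>t(x, A \<inter> G(t))\<close> on \<open>{(t, x). 0 < t < w x}\<close>, the set
  of pairs with \<open>x\<close> in the level set of \<open>t\<close>; outside of it \<open>H\<^sub>t(x, \<cdot>)\<close> is meaningless.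
\<close>

definition measurable_family ::
    "'a measure \<Rightarrow> ('a \<Rightarrow> real) \<Rightarrow> (real \<Rightarrow> 'a \<Rightarrow> 'a measure) \<Rightarrow> bool" where
  "measurable_family \<nu> w H \<longleftrightarrow>
     (\<forall>A \<in> sets \<nu>. (\<lambda>(t, x). emeasure (H t x) (A \<inter> level_set \<nu> w t))
        \<in> borel_measurable
             (restrict_space (borel \<Otimes>\<^sub>M \<nu>) {(t, x). x \<in> space \<nu> \<and> 0 < t \<and> t < w x}))"

text \<open>
  For \<open>0 \<le> \<beta>\<^sub>0 \<le> 1/4\<close> measurable the integrand is integrable, because
  the level masses integrate to \<open>\<integral>w d\<nu>\<close> over all levels.
\<close>

definition averaged_rate ::
    "'a measure \<Rightarrow> ('a \<Rightarrow> real) \<Rightarrow> (real \<Rightarrow> real \<Rightarrow> real) \<Rightarrow> real \<Rightarrow> real" where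
  "averaged_rate \<nu> w \<beta>\<^sub>0 s =
     (LINT t:levels \<nu> w|lborel. \<beta>\<^sub>0 s t * level_mass \<nu> w t) / (\<integral>x. w x \<partial>\<nu>)"

end

theory Submission
  imports Defs
begin

text \<open>
  By Fubini, the Dirichlet form of a hybrid slice sampler is the average over the levels of the
  forms of the kernels on the levels,
  \<open>E\<^sub>\<pi>(H, f) = c\<^sup>-\<^sup>1 \<integral> m(t) E\<^sub>t(H\<^sub>t, f) dt\<close>. The ideal sampler is the hybrid one with
  \<open>H\<^sub>t(x, \<cdot>) = \<nu>\<^sub>t\<close>, for which the form on a level is the variance of \<open>f\<close> under \<open>\<nu>\<^sub>t\<close>. Forms do not
  change when a constant is subtracted from \<open>f\<close>, so on each level \<open>f\<close> may be centred. There,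
  positivity of \<open>H\<^sub>t\<close> gives \<open>E\<^sub>t(H\<^sub>t, f) \<le> Var\<^sub>t(f)\<close>, the weak Poincare inequality bounds
  \<open>Var\<^sub>t(f)\<close> from above, and it remains to integrate over \<open>t\<close>. To avoid integrability questions,
  the averages are compared as integrals of nonnegative functions, via
  \<open>E(P, f) = 1/2 \<integral>\<integral> (f(x) - f(y))\<^sup>2 P(x, dy) \<mu>(dx)\<close>, which only needs \<open>\<mu>\<close> to be \<open>P\<close>-invariant.
\<close>

subsection \<open>Kernels and Dirichlet forms\<close>

lemma markov_kernel_subprob:
  "markov_kernel \<mu> P \<Longrightarrow> P \<in> \<mu> \<rightarrow>\<^sub>M subprob_algebra \<mu>"
  unfolding markov_kernel_def by (rule measurable_prob_algebraD)

lemma markov_kernel_at: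
  assumes "markov_kernel \<mu> P" "x \<in> space \<mu>"
  shows "prob_space (P x)" "sets (P x) = sets \<mu>"
  using measurable_space[OF assms(1)[unfolded markov_kernel_def] assms(2)]
  by (auto simp: space_prob_algebra)

text \<open>Two applications of the integration rule for \<open>bind\<close>. This turns
  reversibility, an identity of measures on the product, into identities of iterated
  integrals.\<close>

lemma nn_integral_joint_measure:
  assumes P: "markov_kernel \<mu> P" and h: "h \<in> borel_measurable (\<mu> \<Otimes>\<^sub>M \<mu>)"
  shows "(\<integral>\<^sup>+z. h z \<partial>joint_measure \<mu> P) = (\<integral>\<^sup>+x. \<integral>\<^sup>+y. h (x, y) \<partial>P x \<partial>\<mu>)"
proof -
  note [measurable] = h
  have [measurable]: "P \<in> \<mu> \<rightarrow>\<^sub>M subprob_algebra \<mu>"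
    by (rule markov_kernel_subprob[OF P])
  have "(\<lambda>x. P x \<bind> (\<lambda>y. return (\<mu> \<Otimes>\<^sub>M \<mu>) (x, y))) \<in> \<mu> \<rightarrow>\<^sub>M subprob_algebra (\<mu> \<Otimes>\<^sub>M \<mu>)"
    by (rule measurable_bind[where N = \<mu>]) measurable
  then have "(\<integral>\<^sup>+z. h z \<partial>joint_measure \<mu> P)
      = (\<integral>\<^sup>+x. \<integral>\<^sup>+z. h z \<partial>(P x \<bind> (\<lambda>y. return (\<mu> \<Otimes>\<^sub>M \<mu>) (x, y))) \<partial>\<mu>)"
    unfolding joint_measure_def using h by (intro nn_integral_bind)
  also have "\<dots> = (\<integral>\<^sup>+x. \<integral>\<^sup>+y. h (x, y) \<partial>P x \<partial>\<mu>)"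
  proof (rule nn_integral_cong)
    fix x assume x: "x \<in> space \<mu>"
    note sets = markov_kernel_at(2)[OF P x]
    have m: "(\<lambda>y. return (\<mu> \<Otimes>\<^sub>M \<mu>) (x, y)) \<in> P x \<rightarrow>\<^sub>M subprob_algebra (\<mu> \<Otimes>\<^sub>M \<mu>)"
      using x unfolding measurable_cong_sets[OF sets refl] by measurable
    have "(\<integral>\<^sup>+z. h z \<partial>(P x \<bind> (\<lambda>y. return (\<mu> \<Otimes>\<^sub>M \<mu>) (x, y))))
        = (\<integral>\<^sup>+y. \<integral>\<^sup>+z. h z \<partial>return (\<mu> \<Otimes>\<^sub>M \<mu>) (x, y) \<partial>P x)"
      by (rule nn_integral_bind[OF h m])
    also have "\<dots> = (\<integral>\<^sup>+y. h (x, y) \<partial>P x)"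
      using x sets_eq_imp_space_eq[OF sets]
      by (intro nn_integral_cong nn_integral_return h) (auto simp: space_pair_measure)
    finally show "(\<integral>\<^sup>+z. h z \<partial>(P x \<bind> (\<lambda>y. return (\<mu> \<Otimes>\<^sub>M \<mu>) (x, y)))) = (\<integral>\<^sup>+y. h (x, y) \<partial>P x)" .
  qed
  finally show ?thesis .
qed

text \<open>Integrate a function of the second coordinate alone: by symmetry it may be read in the
  first coordinate instead, and there the inner integral of a constant against a probability measure
  returns that constant.\<close>

lemma reversible_imp_invariant:
  assumes "reversible \<mu> P" and g [measurable]: "g \<in> borel_measurable \<mu>"
  shows "(\<integral>\<^sup>+x. \<integral>\<^sup>+y. g y \<partial>P x \<partial>\<mu>) = (\<integral>\<^sup>+x. g x \<partial>\<mu>)"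
proof -
  have P: "markov_kernel \<mu> P"
    and swap: "distr (joint_measure \<mu> P) (\<mu> \<Otimes>\<^sub>M \<mu>) prod.swap = joint_measure \<mu> P"
    using assms(1) by (auto simp: reversible_def)
  \<comment> \<open>The swap identity itself reveals the sigma-algebra of the joint measure, since
    \<open>distr\<close> carries that of its target.\<close>
  have sets: "sets (joint_measure \<mu> P) = sets (\<mu> \<Otimes>\<^sub>M \<mu>)"
    by (metis sets_distr swap)
  have meas: "prod.swap \<in> joint_measure \<mu> P \<rightarrow>\<^sub>M \<mu> \<Otimes>\<^sub>M \<mu>"
    unfolding measurable_cong_sets[OF sets refl] prod.swap_def by measurable
  have "(\<integral>\<^sup>+x. \<integral>\<^sup>+y. g y \<partial>P x \<partial>\<mu>) = (\<integral>\<^sup>+z. g (snd z) \<partial>joint_measure \<mu> P)"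
    by (subst nn_integral_joint_measure[OF P]) auto
  also have "\<dots> = (\<integral>\<^sup>+z. g (snd z) \<partial>distr (joint_measure \<mu> P) (\<mu> \<Otimes>\<^sub>M \<mu>) prod.swap)"
    by (simp add: swap)
  also have "\<dots> = (\<integral>\<^sup>+z. g (fst z) \<partial>joint_measure \<mu> P)"
    by (subst nn_integral_distr[OF meas]) auto
  also have "\<dots> = (\<integral>\<^sup>+x. \<integral>\<^sup>+y. g x \<partial>P x \<partial>\<mu>)"
    by (subst nn_integral_joint_measure[OF P]) auto
  also have "\<dots> = (\<integral>\<^sup>+x. g x \<partial>\<mu>)"
    by (intro nn_integral_cong)
      (simp add: prob_space.emeasure_space_1[OF markov_kernel_at(1)[OF P]])
  finally show ?thesis .
qed

text \<open>By invariance, \<open>f\<close> is square integrable under \<open>P x\<close> for almost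
  every \<open>x\<close>, so \<open>(f x - f y)\<^sup>2\<close> can be expanded and integrated
  termwise there. Invariance, rather than reversibility, is assumed because it is what gets proved
  for the hybrid kernel.\<close>

lemma dirichlet_form_invariant_kernel:
  assumes "prob_space \<mu>" and P: "markov_kernel \<mu> P"
    and inv: "\<And>g. g \<in> borel_measurable \<mu> \<Longrightarrow> (\<integral>\<^sup>+x. \<integral>\<^sup>+y. g y \<partial>P x \<partial>\<mu>) = (\<integral>\<^sup>+x. g x \<partial>\<mu>)"
    and f: "f \<in> L2 \<mu>"
  shows "0 \<le> dirichlet_form \<mu> P f"
    and "ennreal (dirichlet_form \<mu> P f)
      = (\<integral>\<^sup>+x. \<integral>\<^sup>+y. ennreal ((f x - f y)\<^sup>2) \<partial>P x \<partial>\<mu>) / 2"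
    and "dirichlet_form \<mu> P f = L2_inner \<mu> f f - L2_inner \<mu> (kernel_op P f) f"
proof -
  interpret prob_space \<mu> by fact
  have [measurable]: "f \<in> borel_measurable \<mu>" and int2: "integrable \<mu> (\<lambda>x. (f x)\<^sup>2)"
    using f by (auto simp: L2_def)
  have [measurable]: "P \<in> \<mu> \<rightarrow>\<^sub>M subprob_algebra \<mu>"
    by (rule markov_kernel_subprob[OF P])
  \<comment> \<open>\<open>q\<close> is \<open>P\<close> applied to the square of \<open>f\<close>,
    and \<open>D\<close> is the inner integral of the energy. As real functions, both take the
    default value 0 on the null set where \<open>f\<close> is not square integrable under
    \<open>P x\<close>.\<close>
  define q where "q x = (\<integral>y. (f y)\<^sup>2 \<partial>P x)" for x
  define D where "D x = enn2real (\<integral>\<^sup>+y. ennreal ((f x - f y)\<^sup>2) \<partial>P x)" for x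
  have meas_op [measurable]: "kernel_op P f \<in> borel_measurable \<mu>"
    unfolding kernel_op_def by measurable
  have [measurable]: "q \<in> borel_measurable \<mu>"
    unfolding q_def by measurable
  have [measurable]: "D \<in> borel_measurable \<mu>"
    unfolding D_def
    by (intro borel_measurable_enn2real nn_integral_measurable_subprob_algebra2[where N = \<mu>]) measurable
  have nn_q: "(\<integral>\<^sup>+x. \<integral>\<^sup>+y. ennreal ((f y)\<^sup>2) \<partial>P x \<partial>\<mu>) = (\<integral>\<^sup>+x. ennreal ((f x)\<^sup>2) \<partial>\<mu>)"
    by (rule inv) measurable
  have fin: "(\<integral>\<^sup>+x. ennreal ((f x)\<^sup>2) \<partial>\<mu>) < \<infinity>"
    using int2 by (simp add: integrable_iff_bounded)
  have "AE x in \<mu>. (\<integral>\<^sup>+y. ennreal ((f y)\<^sup>2) \<partial>P x) \<noteq> \<infinity>"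
    using fin unfolding nn_q[symmetric]
    by (intro nn_integral_noteq_infinite nn_integral_measurable_subprob_algebra2[where N = \<mu>]) auto
  then have AE_all: "AE x in \<mu>. ennreal (q x) = (\<integral>\<^sup>+y. ennreal ((f y)\<^sup>2) \<partial>P x)
      \<and> ennreal (D x) = (\<integral>\<^sup>+y. ennreal ((f x - f y)\<^sup>2) \<partial>P x)
      \<and> D x = (f x)\<^sup>2 - 2 * (f x * kernel_op P f x) + q x
      \<and> D x \<le> 2 * (f x)\<^sup>2 + 2 * q x"
    using AE_space
  proof eventually_elim
    case (elim x)
    interpret P: prob_space "P x" by (rule markov_kernel_at(1)[OF P elim(2)])
    note sets = markov_kernel_at(2)[OF P elim(2)]
    have [measurable]: "f \<in> borel_measurable (P x)"
      unfolding measurable_cong_sets[OF sets refl] by measurable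
    have i2: "integrable (P x) (\<lambda>y. (f y)\<^sup>2)"
      using elim(1) by (simp add: integrable_iff_bounded top.not_eq_extremum)
    have i1: "integrable (P x) f"
      by (rule P.square_integrable_imp_integrable[OF _ i2]) measurable
    have expand: "(f x - f y)\<^sup>2 = (f x)\<^sup>2 - 2 * f x * f y + (f y)\<^sup>2" for y
      by (simp add: power2_diff)
    have iD: "integrable (P x) (\<lambda>y. (f x - f y)\<^sup>2)"
      unfolding expand using i1 i2 by simp
    have D_int: "D x = (\<integral>y. (f x - f y)\<^sup>2 \<partial>P x)"
      unfolding D_def using iD by (simp add: nn_integral_eq_integral)
    have D: "D x = (f x)\<^sup>2 - 2 * (f x * kernel_op P f x) + q x"
      unfolding D_int expand q_def kernel_op_def using i1 i2 by (simp add: P.prob_space)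
    \<comment> \<open>Nonnegativity of this integral controls the cross term and gives
      \<open>D\<close> an integrable majorant.\<close>
    have "0 \<le> (\<integral>y. (f x + f y)\<^sup>2 \<partial>P x)"
      by simp
    then have "0 \<le> (f x)\<^sup>2 + 2 * (f x * kernel_op P f x) + q x"
      unfolding power2_sum q_def kernel_op_def using i1 i2 by (simp add: P.prob_space)
    with D have "D x \<le> 2 * (f x)\<^sup>2 + 2 * q x"
      by linarith
    with D show ?case
      unfolding D_int q_def using i2 iD by (simp add: nn_integral_eq_integral)
  qed
  have q0: "0 \<le> q x" and D0: "0 \<le> D x" for x
    by (simp_all add: q_def D_def)
  have nn_q': "(\<integral>\<^sup>+x. ennreal (q x) \<partial>\<mu>) = (\<integral>\<^sup>+x. ennreal ((f x)\<^sup>2) \<partial>\<mu>)"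
    unfolding nn_q[symmetric] using AE_all by (intro nn_integral_cong_AE) auto
  then have iq: "integrable \<mu> q"
    using fin q0 by (simp add: integrable_iff_bounded)
  have int_q: "(\<integral>x. q x \<partial>\<mu>) = (\<integral>x. (f x)\<^sup>2 \<partial>\<mu>)"
    using nn_q' q0 by (simp add: integral_eq_nn_integral)
  have iD: "integrable \<mu> D"
    by (rule Bochner_Integration.integrable_bound[where f = "\<lambda>x. 2 * (f x)\<^sup>2 + 2 * q x"])
       (use int2 iq AE_all D0 q0 in auto)
  \<comment> \<open>The expansion of \<open>D\<close>, solved for
    \<open>(f x - kernel_op P f x) * f x\<close>. After integration the terms
    \<open>(f x)\<^sup>2\<close> and \<open>q x\<close> cancel by invariance.\<close>
  have "dirichlet_form \<mu> P f = (\<integral>x. ((f x)\<^sup>2 - q x + D x) / 2 \<partial>\<mu>)"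
    unfolding dirichlet_form_def L2_inner_def using AE_all
    by (intro integral_cong_AE) (auto simp: power2_eq_square algebra_simps)
  also have "\<dots> = (\<integral>x. D x \<partial>\<mu>) / 2"
    using int2 iq iD int_q by simp
  finally have eq: "dirichlet_form \<mu> P f = (\<integral>x. D x \<partial>\<mu>) / 2" .
  have "0 \<le> (\<integral>x. D x \<partial>\<mu>)"
    using D0 by simp
  then show "0 \<le> dirichlet_form \<mu> P f"
    unfolding eq by simp
  have "ennreal (\<integral>x. D x \<partial>\<mu>) = (\<integral>\<^sup>+x. \<integral>\<^sup>+y. ennreal ((f x - f y)\<^sup>2) \<partial>P x \<partial>\<mu>)"
    using AE_all iD D0 by (subst nn_integral_eq_integral[symmetric]) (auto intro!: nn_integral_cong_AE)
  then show "ennreal (dirichlet_form \<mu> P f)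
      = (\<integral>\<^sup>+x. \<integral>\<^sup>+y. ennreal ((f x - f y)\<^sup>2) \<partial>P x \<partial>\<mu>) / 2"
    unfolding eq using D0 by (simp add: divide_ennreal[symmetric])
  \<comment> \<open>The same expansion, solved for the cross term, shows that it is integrable, so
    that the integral defining the form may be split.\<close>
  have "integrable \<mu> (\<lambda>x. ((f x)\<^sup>2 + q x - D x) / 2)"
    using int2 iq iD by simp
  also have "?this \<longleftrightarrow> integrable \<mu> (\<lambda>x. kernel_op P f x * f x)"
    using AE_all by (intro integrable_cong_AE) (auto simp: algebra_simps)
  finally show "dirichlet_form \<mu> P f = L2_inner \<mu> f f - L2_inner \<mu> (kernel_op P f) f"
    unfolding dirichlet_form_def L2_inner_def using int2
    by (simp add: left_diff_distrib power2_eq_square)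
qed

section \<open>Centring, and the kernel that forgets its starting point\<close>

lemma (in prob_space) L2_diff_const:
  assumes "f \<in> L2 M" shows "(\<lambda>x. f x - a) \<in> L2 M"
proof -
  have [measurable]: "f \<in> borel_measurable M" and i2: "integrable M (\<lambda>x. (f x)\<^sup>2)"
    using assms by (auto simp: L2_def)
  have "integrable M f"
    by (rule square_integrable_imp_integrable[OF _ i2]) measurable
  then show ?thesis
    using i2 by (simp add: L2_def power2_diff)
qed

text \<open>The energy formula sees only the differences \<open>f x - f y\<close>. It lives in
  \<open>ennreal\<close>; nonnegativity of both forms brings the equality back to the reals.\<close>

lemma dirichlet_form_diff_const:
  assumes "prob_space \<mu>" and "reversible \<mu> P" and f: "f \<in> L2 \<mu>"
  shows "dirichlet_form \<mu> P (\<lambda>x. f x - a) = dirichlet_form \<mu> P f"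
proof -
  have P: "markov_kernel \<mu> P"
    using assms(2) by (simp add: reversible_def)
  note E = dirichlet_form_invariant_kernel[OF assms(1) P reversible_imp_invariant[OF assms(2)]]
  note f' = prob_space.L2_diff_const[OF assms(1) f, of a]
  have "ennreal (dirichlet_form \<mu> P (\<lambda>x. f x - a)) = ennreal (dirichlet_form \<mu> P f)"
    by (simp add: E(2)[OF _ f] E(2)[OF _ f'])
  then show ?thesis
    by (simp add: E(1)[OF _ f] E(1)[OF _ f'])
qed

text \<open>The joint measure is the product of \<open>M\<close> with itself, which is symmetric.
  This is the ideal move on a single level.\<close>

lemma (in prob_space) reversible_const: "reversible M (\<lambda>_. M)"
proof -
  have "markov_kernel M (\<lambda>_. M)"
    unfolding markov_kernel_def
    by (rule measurable_const) (simp add: space_prob_algebra prob_space_axioms)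
  moreover interpret pair_prob_space M M ..
  have "joint_measure M (\<lambda>_. M) = M \<Otimes>\<^sub>M M"
    unfolding joint_measure_def by (rule pair_measure_eq_bind[symmetric])
  moreover have "distr (M \<Otimes>\<^sub>M M) (M \<Otimes>\<^sub>M M) prod.swap = M \<Otimes>\<^sub>M M"
    using distr_pair_swap unfolding split_beta' prod.swap_def by (rule sym)
  ultimately show ?thesis
    by (simp add: reversible_def)
qed

section \<open>Essential bounds and oscillation\<close>

lemma essinf_le_AE: "AE x in M. essinf M f \<le> f x"
  using esssup_AE[of "\<lambda>x. - f x" M]
  by (auto simp: essinf_def ereal_uminus_le_reorder)

text \<open>A property that holds almost everywhere for a probability measure holds at some point.
  The real value of \<open>f\<close> at such a point separates the two essential bounds, which also
  excludes a difference of equal infinities.\<close>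

lemma (in prob_space) osc_norm_nonneg: "0 \<le> osc_norm M f"
proof -
  have "AE x in M. essinf M (\<lambda>x. ereal (f x)) \<le> ereal (f x) \<and> ereal (f x) \<le> esssup M (\<lambda>x. ereal (f x))"
    using essinf_le_AE esssup_AE by eventually_elim simp
  moreover have "ae_filter M \<noteq> bot"
    by (simp add: ae_filter_eq_bot_iff emeasure_space_1)
  ultimately obtain x where "essinf M (\<lambda>x. ereal (f x)) \<le> ereal (f x)"
      "ereal (f x) \<le> esssup M (\<lambda>x. ereal (f x))"
    using eventually_happens' by blast
  then show ?thesis
    unfolding osc_norm_def by (cases "esssup M (\<lambda>x. ereal (f x))"; cases "essinf M (\<lambda>x. ereal (f x))") auto
qed

text \<open>The shift by \<open>a\<close> cancels between the upper and the lower bound. Real bounds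
  keep the extended-real arithmetic unambiguous.\<close>

lemma osc_norm_diff_le:
  assumes [measurable]: "f \<in> borel_measurable N" and "AE x in N. lo \<le> f x" "AE x in N. f x \<le> hi"
  shows "osc_norm N (\<lambda>x. f x - a) \<le> ereal (hi - lo)"
proof -
  have "esssup N (\<lambda>x. ereal (f x - a)) \<le> ereal (hi - a)"
    using assms(3) by (intro esssup_I) auto
  moreover have "esssup N (\<lambda>x. - ereal (f x - a)) \<le> ereal (a - lo)"
    using assms(2) by (intro esssup_I) auto
  ultimately have "esssup N (\<lambda>x. ereal (f x - a)) + esssup N (\<lambda>x. - ereal (f x - a))
      \<le> ereal (hi - a) + ereal (a - lo)"
    by (rule add_mono)
  then show ?thesis
    by (simp add: osc_norm_def essinf_def minus_ereal_def)
qed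

subsection \<open>Level sets of the target density\<close>

locale slice_target = sigma_finite_measure \<nu> for \<nu> :: "'a measure" +
  fixes w :: "'a \<Rightarrow> real"
  assumes w_measurable [measurable]: "w \<in> borel_measurable \<nu>"
    and w_pos: "\<And>x. x \<in> space \<nu> \<Longrightarrow> 0 < w x"
    and w_integrable: "integrable \<nu> w"
    and w_integral_pos: "0 < (\<integral>x. w x \<partial>\<nu>)"
    and w_sup: "(SUP x\<in>space \<nu>. ereal (w x)) = esssup \<nu> (\<lambda>x. ereal (w x))"
begin

abbreviation "c \<equiv> \<integral>x. w x \<partial>\<nu>"
abbreviation "T \<equiv> levels \<nu> w"
abbreviation "G \<equiv> level_set \<nu> w"
abbreviation "m \<equiv> level_mass \<nu> w"
abbreviation "\<pi> \<equiv> target_measure \<nu> w"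
abbreviation "\<nu>\<^sub>t \<equiv> level_uniform_on \<nu> w"

lemma level_set_measurable [measurable]: "G t \<in> sets \<nu>"
  unfolding level_set_def by measurable

lemma levels_measurable [measurable]: "T \<in> sets borel"
  unfolding levels_def by measurable

lemma levelsI:
  assumes "x \<in> space \<nu>" "0 < t" "t < w x"
  shows "t \<in> T"
proof -
  have "ereal t < ereal (w x)" using assms by simp
  also have "\<dots> \<le> (SUP x\<in>space \<nu>. ereal (w x))" by (rule SUP_upper[OF assms(1)])
  finally show ?thesis using assms by (simp add: levels_def)
qed

lemma levels_pos: "t \<in> T \<Longrightarrow> 0 < t"
  by (simp add: levels_def)

lemma nn_integral_w: "(\<integral>\<^sup>+x. ennreal (w x) \<partial>\<nu>) = ennreal c"
  using w_pos w_integrable by (intro nn_integral_eq_integral AE_I2) (auto simp: less_imp_le)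

text \<open>Finiteness is Markov's inequality: \<open>t\<close> times the measure of
  \<open>G t\<close> is at most \<open>c\<close>. Positivity is where \<open>w_sup\<close> enters: a
  level below the supremum lies below the essential supremum, so \<open>w\<close> exceeds it on a
  set of positive measure.\<close>

lemma emeasure_level_set:
  assumes "t \<in> T"
  shows "emeasure \<nu> (G t) = ennreal (m t)" "0 < m t"
proof -
  have "ennreal t * emeasure \<nu> (G t) = (\<integral>\<^sup>+x. ennreal t * indicator (G t) x \<partial>\<nu>)"
    by (simp add: nn_integral_cmult_indicator)
  also have "\<dots> \<le> (\<integral>\<^sup>+x. ennreal (w x) \<partial>\<nu>)"
    by (intro nn_integral_mono) (auto simp: level_set_def indicator_def intro!: ennreal_leI)
  also have "\<dots> < \<infinity>" by (simp add: nn_integral_w)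
  finally have "emeasure \<nu> (G t) \<noteq> \<infinity>"
    using levels_pos[OF assms] by (auto simp: ennreal_mult_top)
  then show eq: "emeasure \<nu> (G t) = ennreal (m t)"
    unfolding level_mass_def by (simp add: emeasure_eq_ennreal_measure)
  have "0 < emeasure \<nu> {x \<in> space \<nu>. ereal t < ereal (w x)}"
    using assms unfolding levels_def w_sup by (intro esssup_pos_measure) auto
  then show "0 < m t"
    using eq by (simp add: level_set_def)
qed

lemma sets_\<nu>\<^sub>t: "sets (\<nu>\<^sub>t t) = sets (restrict_space \<nu> (G t))"
  unfolding level_uniform_on_def level_uniform_def by (intro sets_restrict_space_cong) simp

lemma space_\<nu>\<^sub>t: "space (\<nu>\<^sub>t t) = G t"
  unfolding level_uniform_on_def level_uniform_def
  using sets.sets_into_space[OF level_set_measurable] by (auto simp: space_restrict_space)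

lemma measurable_\<nu>\<^sub>t: "g \<in> borel_measurable \<nu> \<Longrightarrow> g \<in> borel_measurable (\<nu>\<^sub>t t)"
  unfolding measurable_cong_sets[OF sets_\<nu>\<^sub>t refl] by (rule measurable_restrict_space1)

lemma nn_integral_\<nu>\<^sub>t:
  assumes t: "t \<in> T" and [measurable]: "g \<in> borel_measurable \<nu>"
  shows "ennreal (m t) * (\<integral>\<^sup>+x. g x \<partial>\<nu>\<^sub>t t) = (\<integral>\<^sup>+x. g x * indicator (G t) x \<partial>\<nu>)"
proof -
  have "(\<integral>\<^sup>+x. g x \<partial>\<nu>\<^sub>t t) = (\<integral>\<^sup>+x. g x * indicator (G t) x * indicator (G t) x \<partial>\<nu>) / ennreal (m t)"
    unfolding level_uniform_on_def level_uniform_def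
    by (simp add: nn_integral_restrict_space nn_integral_uniform_measure emeasure_level_set[OF t])
  also have "(\<integral>\<^sup>+x. g x * indicator (G t) x * indicator (G t) x \<partial>\<nu>) = (\<integral>\<^sup>+x. g x * indicator (G t) x \<partial>\<nu>)"
    by (intro nn_integral_cong) (auto simp: indicator_def)
  finally show ?thesis
    using emeasure_level_set(2)[OF t]
    by (simp add: ennreal_times_divide mult.commute[of "ennreal (m t)"] ennreal_mult_divide_eq)
qed

lemma prob_space_\<nu>\<^sub>t:
  assumes t: "t \<in> T" shows "prob_space (\<nu>\<^sub>t t)"
proof (rule prob_spaceI)
  have "ennreal (m t) * emeasure (\<nu>\<^sub>t t) (space (\<nu>\<^sub>t t)) = ennreal (m t) * 1"
    using nn_integral_\<nu>\<^sub>t[OF t, of "\<lambda>_. 1"] by (simp add: emeasure_level_set(1)[OF t])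
  then show "emeasure (\<nu>\<^sub>t t) (space (\<nu>\<^sub>t t)) = 1"
    using emeasure_level_set(2)[OF t] unfolding ennreal_mult_cancel_left by simp
qed

section \<open>The target measure and its relation to the levels\<close>

lemma sets_\<pi>: "sets \<pi> = sets \<nu>"
  by (simp add: target_measure_def)

lemma measurable_\<pi>: "borel_measurable \<pi> = borel_measurable \<nu>"
  by (rule measurable_cong_sets[OF sets_\<pi> refl])

lemma nn_integral_\<pi>:
  assumes [measurable]: "g \<in> borel_measurable \<nu>"
  shows "(\<integral>\<^sup>+x. g x \<partial>\<pi>) = (\<integral>\<^sup>+x. ennreal (w x) * g x \<partial>\<nu>) / ennreal c"
proof -
  have "(\<integral>\<^sup>+x. g x \<partial>\<pi>) = (\<integral>\<^sup>+x. ennreal (w x / c) * g x \<partial>\<nu>)"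
    unfolding target_measure_def by (intro nn_integral_density) auto
  also have "\<dots> = (\<integral>\<^sup>+x. ennreal (w x) * g x / ennreal c \<partial>\<nu>)"
    using w_pos w_integral_pos
    by (intro nn_integral_cong)
      (simp add: divide_ennreal[symmetric] less_imp_le ennreal_divide_times ennreal_times_divide mult.commute)
  finally show ?thesis by (simp add: nn_integral_divide)
qed

text \<open>On \<open>G t\<close> the constant \<open>t\<close> is below \<open>w\<close>, so
  \<open>t * m t\<close> times the second moment of \<open>f\<close> under
  \<open>\<nu>\<^sub>t t\<close> is at most \<open>c\<close> times its second moment under \<pi>;
  both \<open>t\<close> and \<open>m t\<close> are positive.\<close>

lemma L2_\<nu>\<^sub>t:
  assumes t: "t \<in> T" and f: "f \<in> L2 \<pi>" shows "f \<in> L2 (\<nu>\<^sub>t t)"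
proof -
  have [measurable]: "f \<in> borel_measurable \<nu>" and "integrable \<pi> (\<lambda>x. (f x)\<^sup>2)"
    using f by (auto simp: L2_def measurable_\<pi>)
  then have fin: "(\<integral>\<^sup>+x. ennreal ((f x)\<^sup>2) \<partial>\<pi>) < \<infinity>"
    by (simp add: integrable_iff_bounded)
  have "ennreal t * (ennreal (m t) * (\<integral>\<^sup>+x. ennreal ((f x)\<^sup>2) \<partial>\<nu>\<^sub>t t))
      = (\<integral>\<^sup>+x. ennreal t * (ennreal ((f x)\<^sup>2) * indicator (G t) x) \<partial>\<nu>)"
    by (simp add: nn_integral_\<nu>\<^sub>t[OF t] nn_integral_cmult)
  also have "\<dots> \<le> (\<integral>\<^sup>+x. ennreal (w x) * ennreal ((f x)\<^sup>2) \<partial>\<nu>)"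
    by (intro nn_integral_mono)
      (auto simp: level_set_def indicator_def intro!: mult_right_mono ennreal_leI)
  also have "\<dots> < \<infinity>"
    using fin w_integral_pos by (auto simp: nn_integral_\<pi> ennreal_divide_eq_top_iff top.not_eq_extremum[symmetric])
  finally have "(\<integral>\<^sup>+x. ennreal ((f x)\<^sup>2) \<partial>\<nu>\<^sub>t t) \<noteq> \<infinity>"
    using levels_pos[OF t] emeasure_level_set(2)[OF t] by (auto simp: ennreal_mult_top)
  then show ?thesis
    by (simp add: L2_def integrable_iff_bounded measurable_\<nu>\<^sub>t less_top)
qed

lemma prob_space_\<pi>: "prob_space \<pi>"
proof (rule prob_spaceI)
  show "emeasure \<pi> (space \<pi>) = 1"
    using nn_integral_\<pi>[of "\<lambda>_. 1"] w_integral_pos by (simp add: nn_integral_w ennreal_divide_self)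
qed

end

subsection \<open>Hybrid slice sampling\<close>

locale slice_kernel = slice_target +
  fixes H :: "real \<Rightarrow> 'a \<Rightarrow> 'a measure"
  assumes reversible: "\<And>t. t \<in> T \<Longrightarrow> reversible (\<nu>\<^sub>t t) (H t)"
    and measurable_family: "measurable_family \<nu> w H"
begin

abbreviation below :: "(real \<times> 'a) set" where
  "below \<equiv> {(t, x). x \<in> space \<nu> \<and> 0 < t \<and> t < w x}"

text \<open>The branch outside of \<open>below\<close> is a filler that makes \<open>slice\<close> a Markov kernel everywhere.\<close>

definition slice :: "real \<Rightarrow> 'a \<Rightarrow> 'a measure" where
  "slice t x = (if (t, x) \<in> below then distr (H t x) \<nu> (\<lambda>y. y) else return \<nu> x)"

lemma below_measurable [measurable]: "below \<in> sets (borel \<Otimes>\<^sub>M \<nu>)"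
proof -
  have "below = {p \<in> space (borel \<Otimes>\<^sub>M \<nu>). 0 < fst p \<and> fst p < w (snd p)}"
    by (auto simp: space_pair_measure)
  also have "\<dots> \<in> sets (borel \<Otimes>\<^sub>M \<nu>)" by measurable
  finally show ?thesis .
qed

lemma markov_level: "t \<in> T \<Longrightarrow> markov_kernel (\<nu>\<^sub>t t) (H t)"
  using reversible by (simp add: reversible_def)

text \<open>The last claim is what makes \<open>slice\<close> work: the identity is measurable from
  a level set with its trace sigma-algebra into the whole space, so \<open>distr\<close> along it
  extends \<open>H t x\<close> to a measure on the whole space.\<close>

lemma belowD:
  assumes "(t, x) \<in> below"
  shows "t \<in> T" "prob_space (H t x)" "sets (H t x) = sets (\<nu>\<^sub>t t)"
    "(\<lambda>y. y) \<in> H t x \<rightarrow>\<^sub>M \<nu>"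
proof -
  show t: "t \<in> T" using levelsI assms by auto
  have x: "x \<in> G t" using assms by (simp add: level_set_def)
  show "prob_space (H t x)" and sets: "sets (H t x) = sets (\<nu>\<^sub>t t)"
    using markov_kernel_at[OF markov_level[OF t]] x by (auto simp: space_\<nu>\<^sub>t)
  show "(\<lambda>y. y) \<in> H t x \<rightarrow>\<^sub>M \<nu>"
    unfolding measurable_cong_sets[OF sets refl] measurable_cong_sets[OF sets_\<nu>\<^sub>t refl]
    by (intro measurable_restrict_space1) simp
qed

lemma emeasure_slice:
  assumes "(t, x) \<in> below" "A \<in> sets \<nu>"
  shows "emeasure (slice t x) A = emeasure (H t x) (A \<inter> G t)"
proof -
  have "space (H t x) = G t"
    using sets_eq_imp_space_eq[OF belowD(3)[OF assms(1)]] by (simp add: space_\<nu>\<^sub>t)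
  then show ?thesis
    using assms belowD(4)[OF assms(1)] by (simp add: slice_def emeasure_distr)
qed

lemma nn_integral_slice:
  assumes "(t, x) \<in> below" "g \<in> borel_measurable \<nu>"
  shows "(\<integral>\<^sup>+y. g y \<partial>slice t x) = (\<integral>\<^sup>+y. g y \<partial>H t x)"
  using assms belowD(4)[OF assms(1)] by (simp add: slice_def nn_integral_distr)

text \<open>For a fixed set \<open>A\<close> the mass is measurable separately on the two branches:
  on \<open>below\<close> this is \<open>measurable_family\<close>, and off it the mass is the
  indicator of \<open>A\<close>.\<close>

lemma slice_measurable [measurable]:
  "(\<lambda>(t, x). slice t x) \<in> borel \<Otimes>\<^sub>M \<nu> \<rightarrow>\<^sub>M prob_algebra \<nu>"
proof (rule measurable_prob_algebraI)
  fix p assume "p \<in> space (borel \<Otimes>\<^sub>M \<nu> :: (real \<times> 'a) measure)"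
  then show "prob_space (case p of (t, x) \<Rightarrow> slice t x)"
    using belowD by (auto simp: slice_def space_pair_measure intro!: prob_space.prob_space_distr prob_space_return)
next
  show "(\<lambda>(t, x). slice t x) \<in> borel \<Otimes>\<^sub>M \<nu> \<rightarrow>\<^sub>M subprob_algebra \<nu>"
  proof (rule measurable_subprob_algebra)
    fix p assume "p \<in> space (borel \<Otimes>\<^sub>M \<nu> :: (real \<times> 'a) measure)"
    then show "subprob_space (case p of (t, x) \<Rightarrow> slice t x)"
      using belowD by (auto simp: slice_def space_pair_measure
        intro!: prob_space_imp_subprob_space prob_space.prob_space_distr prob_space_return)
  next
    fix p show "sets (case p of (t, x) \<Rightarrow> slice t x) = sets \<nu>"
      by (auto simp: slice_def split: prod.split)
  next
    fix A assume A [measurable]: "A \<in> sets \<nu>"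
    have "(\<lambda>p. if p \<in> below then emeasure (H (fst p) (snd p)) (A \<inter> G (fst p)) else indicator A (snd p))
        \<in> borel_measurable (borel \<Otimes>\<^sub>M \<nu>)"
    proof (subst measurable_If_restrict_space_iff)
      show "{x \<in> space (borel \<Otimes>\<^sub>M \<nu>). x \<in> below} \<in> sets (borel \<Otimes>\<^sub>M \<nu>)"
        by measurable
      have "(\<lambda>p. emeasure (H (fst p) (snd p)) (A \<inter> G (fst p))) \<in> borel_measurable (restrict_space (borel \<Otimes>\<^sub>M \<nu>) below)"
        using measurable_family A by (simp add: measurable_family_def split_beta')
      moreover have "(\<lambda>p. indicator A (snd p) :: ennreal) \<in> borel_measurable (restrict_space (borel \<Otimes>\<^sub>M \<nu>) {x. x \<notin> below})"
        by (intro measurable_restrict_space1) measurable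
      ultimately show "(\<lambda>p. emeasure (H (fst p) (snd p)) (A \<inter> G (fst p)))
          \<in> borel_measurable (restrict_space (borel \<Otimes>\<^sub>M \<nu>) {x. x \<in> below}) \<and>
        (\<lambda>p. indicator A (snd p) :: ennreal) \<in> borel_measurable (restrict_space (borel \<Otimes>\<^sub>M \<nu>) {x. x \<notin> below})"
        by simp
    qed
    also have "?this \<longleftrightarrow> (\<lambda>p. emeasure (case p of (t, x) \<Rightarrow> slice t x) A) \<in> borel_measurable (borel \<Otimes>\<^sub>M \<nu>)"
    proof (rule measurable_cong)
      fix p assume "p \<in> space (borel \<Otimes>\<^sub>M \<nu> :: (real \<times> 'a) measure)"
      then show "(if p \<in> below then emeasure (H (fst p) (snd p)) (A \<inter> G (fst p)) else indicator A (snd p))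
          = emeasure (case p of (t, x) \<Rightarrow> slice t x) A"
        using emeasure_slice[of "fst p" "snd p" A] A
        by (cases p) (auto simp: slice_def)
    qed
    finally show "(\<lambda>p. emeasure (case p of (t, x) \<Rightarrow> slice t x) A) \<in> borel_measurable (borel \<Otimes>\<^sub>M \<nu>)" .
  qed
qed

text \<open>The first stage of a slice sampling move draws a height uniformly under the graph of
  \<open>w\<close>. The mass of a set is an integral over \<open>t\<close> of a function jointly
  measurable in \<open>t\<close> and \<open>x\<close>, divided by \<open>w x\<close>.\<close>

lemma uniform_height_measurable [measurable]:
  "(\<lambda>x. uniform_measure lborel {0<..<w x}) \<in> \<nu> \<rightarrow>\<^sub>M prob_algebra borel"
proof (rule measurable_prob_algebraI)
  fix x assume "x \<in> space \<nu>"
  then show ps: "prob_space (uniform_measure lborel {0<..<w x})"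
    using w_pos[of x] by (intro prob_space_uniform_measure) (auto simp: less_imp_le)
next
  show "(\<lambda>x. uniform_measure lborel {0<..<w x}) \<in> \<nu> \<rightarrow>\<^sub>M subprob_algebra borel"
  proof (rule measurable_subprob_algebra)
    fix x assume "x \<in> space \<nu>"
    then show "subprob_space (uniform_measure lborel {0<..<w x})"
      using w_pos[of x] by (intro prob_space_imp_subprob_space prob_space_uniform_measure) (auto simp: less_imp_le)
  next
    fix A :: "real set" assume [measurable]: "A \<in> sets borel"
    have "(\<lambda>x. (\<integral>\<^sup>+t. (if 0 < t \<and> t < w x then indicator A t else 0) \<partial>lborel) / ennreal (w x)) \<in> borel_measurable \<nu>"
      by measurable
    also have "?this \<longleftrightarrow> (\<lambda>x. emeasure (uniform_measure lborel {0<..<w x}) A) \<in> borel_measurable \<nu>"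
    proof (rule measurable_cong)
      fix x assume "x \<in> space \<nu>"
      have "(\<integral>\<^sup>+t. (if 0 < t \<and> t < w x then indicator A t else 0) \<partial>lborel)
          = (\<integral>\<^sup>+t. indicator ({0<..<w x} \<inter> A) t \<partial>lborel)"
        by (intro nn_integral_cong) (auto simp: indicator_def)
      also have "\<dots> = emeasure lborel ({0<..<w x} \<inter> A)"
        by simp
      finally show "(\<integral>\<^sup>+t. (if 0 < t \<and> t < w x then indicator A t else 0) \<partial>lborel) / ennreal (w x)
          = emeasure (uniform_measure lborel {0<..<w x}) A"
        using w_pos[OF \<open>x \<in> space \<nu>\<close>] by (simp add: emeasure_uniform_measure)
    qed
    finally show "(\<lambda>x. emeasure (uniform_measure lborel {0<..<w x}) A) \<in> borel_measurable \<nu>" .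
  qed simp
qed

lemma slice_measurable1 [measurable]:
  assumes "x \<in> space \<nu>"
  shows "(\<lambda>t. slice t x) \<in> borel \<rightarrow>\<^sub>M prob_algebra \<nu>"
  using measurable_compose[OF measurable_Pair2'[OF assms] slice_measurable] by simp

lemma nn_integral_uniform_height:
  assumes "x \<in> space \<nu>" and [measurable]: "h \<in> borel_measurable borel"
  shows "(\<integral>\<^sup>+t. h t \<partial>uniform_measure lborel {0<..<w x})
    = (\<integral>\<^sup>+t\<in>{0<..<w x}. h t \<partial>lborel) / ennreal (w x)"
  using w_pos[OF assms(1)] by (simp add: nn_integral_uniform_measure)

text \<open>The two-stage description of a move: draw the height, then move on its level. It
  identifies the set function of the definition with a genuine measure, and gives measurability,
  total mass 1 and the integration rule through \<open>bind\<close>.\<close>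

lemma hybrid_slice_eq_bind:
  assumes x: "x \<in> space \<nu>"
  shows "hybrid_slice \<nu> w H x = uniform_measure lborel {0<..<w x} \<bind> (\<lambda>t. slice t x)"
proof -
  let ?B = "uniform_measure lborel {0<..<w x} \<bind> (\<lambda>t. slice t x)"
  have ms: "(\<lambda>t. slice t x) \<in> uniform_measure lborel {0<..<w x} \<rightarrow>\<^sub>M subprob_algebra \<nu>"
    using measurable_prob_algebraD[OF slice_measurable1[OF x]] by simp
  have sets: "sets ?B = sets \<nu>"
    by (rule sets_bind_measurable[OF ms]) simp
  have "(\<integral>\<^sup>+t\<in>{0<..<w x}. emeasure (H t x) (A \<inter> G t) \<partial>lborel) / ennreal (w x) = emeasure ?B A"
    if A: "A \<in> sets \<nu>" for A
  proof -
    have [measurable]: "(\<lambda>t. emeasure (slice t x) A) \<in> borel_measurable borel"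
      using measurable_emeasure_kernel[OF measurable_prob_algebraD[OF slice_measurable1[OF x]] A] .
    have "emeasure ?B A = (\<integral>\<^sup>+t\<in>{0<..<w x}. emeasure (slice t x) A \<partial>lborel) / ennreal (w x)"
      by (simp add: emeasure_bind[OF _ ms A] nn_integral_uniform_height[OF x])
    also have "(\<integral>\<^sup>+t\<in>{0<..<w x}. emeasure (slice t x) A \<partial>lborel)
        = (\<integral>\<^sup>+t\<in>{0<..<w x}. emeasure (H t x) (A \<inter> G t) \<partial>lborel)"
      using x A by (intro nn_integral_cong) (auto simp: indicator_def emeasure_slice)
    finally show ?thesis by simp
  qed
  then have "hybrid_slice \<nu> w H x = measure_of (space \<nu>) (sets \<nu>) (emeasure ?B)"
    unfolding hybrid_slice_def
    by (intro measure_of_eq sets.space_closed) (simp add: sets.sigma_sets_eq)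
  also have "\<dots> = ?B"
    using measure_of_of_measure[of ?B] by (simp add: sets sets_eq_imp_space_eq[OF sets])
  finally show ?thesis .
qed

lemma hybrid_measurable: "hybrid_slice \<nu> w H \<in> \<nu> \<rightarrow>\<^sub>M prob_algebra \<nu>"
proof -
  have "(\<lambda>x. uniform_measure lborel {0<..<w x} \<bind> (\<lambda>t. slice t x)) \<in> \<nu> \<rightarrow>\<^sub>M prob_algebra \<nu>"
    by (rule measurable_bind_prob_space2[where N = borel]) measurable
  then show ?thesis
    by (simp add: hybrid_slice_eq_bind cong: measurable_cong)
qed

lemma markov_hybrid: "markov_kernel \<pi> (hybrid_slice \<nu> w H)"
  using hybrid_measurable unfolding markov_kernel_def prob_algebra_def
  by (simp add: subprob_algebra_cong[OF sets_\<pi>] measurable_cong_sets[OF sets_\<pi> refl])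

lemma nn_integral_hybrid:
  assumes x: "x \<in> space \<nu>" and g: "g \<in> borel_measurable \<nu>"
  shows "(\<integral>\<^sup>+y. g y \<partial>hybrid_slice \<nu> w H x)
    = (\<integral>\<^sup>+t\<in>{0<..<w x}. (\<integral>\<^sup>+y. g y \<partial>slice t x) \<partial>lborel) / ennreal (w x)"
proof -
  have ms: "(\<lambda>t. slice t x) \<in> borel \<rightarrow>\<^sub>M subprob_algebra \<nu>"
    by (rule measurable_prob_algebraD[OF slice_measurable1[OF x]])
  have "(\<lambda>t. \<integral>\<^sup>+y. g y \<partial>slice t x) \<in> borel_measurable borel"
    using measurable_compose[OF measurable_snd g]
    by (intro nn_integral_measurable_subprob_algebra2[OF _ ms]) (simp add: split_beta')
  moreover have "(\<integral>\<^sup>+y. g y \<partial>hybrid_slice \<nu> w H x)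
      = (\<integral>\<^sup>+t. \<integral>\<^sup>+y. g y \<partial>slice t x \<partial>uniform_measure lborel {0<..<w x})"
    unfolding hybrid_slice_eq_bind[OF x] using ms by (intro nn_integral_bind[OF g]) simp
  ultimately show ?thesis
    by (simp add: nn_integral_uniform_height[OF x])
qed

text \<open>The weight \<open>w x\<close> of \<pi> cancels the factor \<open>1 / w x\<close> of the
  kernel, which leaves an integral over the region below the graph of \<open>w\<close>. Tonelli
  exchanges points and levels; the section of the region at level \<open>t\<close> is
  \<open>G t\<close>, where \<nu> is \<open>m t\<close> times \<open>\<nu>\<^sub>t t\<close>. A
  general \<open>g\<close> serves invariance, the energy and the total level mass alike.\<close>

lemma nn_integral_hybrid_joint:
  assumes g [measurable]: "(\<lambda>(x, y). g x y) \<in> borel_measurable (\<nu> \<Otimes>\<^sub>M \<nu>)"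
  defines "F \<equiv> \<lambda>t. ennreal (m t) * (\<integral>\<^sup>+x. \<integral>\<^sup>+y. g x y \<partial>H t x \<partial>\<nu>\<^sub>t t)"
  shows "(\<integral>\<^sup>+x. \<integral>\<^sup>+y. g x y \<partial>hybrid_slice \<nu> w H x \<partial>\<pi>) = (\<integral>\<^sup>+t\<in>T. F t \<partial>lborel) / ennreal c"
    and "(\<lambda>t. F t * indicator T t) \<in> borel_measurable borel"
proof -
  interpret lb: pair_sigma_finite lborel \<nu> ..
  define k where "k t x = (\<integral>\<^sup>+y. g x y \<partial>slice t x)" for t x
  have sl: "(\<lambda>p. slice (fst p) (snd p)) \<in> borel \<Otimes>\<^sub>M \<nu> \<rightarrow>\<^sub>M subprob_algebra \<nu>"
    using measurable_prob_algebraD[OF slice_measurable] by (simp add: split_beta')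
  have "(\<lambda>(p, y). g (snd p) y) \<in> borel_measurable ((borel \<Otimes>\<^sub>M \<nu>) \<Otimes>\<^sub>M \<nu>)"
    using g by measurable
  from nn_integral_measurable_subprob_algebra2[OF this sl]
  have k [measurable]: "(\<lambda>p. k (fst p) (snd p)) \<in> borel_measurable (borel \<Otimes>\<^sub>M \<nu>)"
    by (simp add: k_def)
  have k1: "k t \<in> borel_measurable \<nu>" for t
    using measurable_compose[OF measurable_Pair1'[of t borel \<nu>] k] by simp
  have gx: "g x \<in> borel_measurable \<nu>" if "x \<in> space \<nu>" for x
    using measurable_compose[OF measurable_Pair1'[OF that] g] by simp
  \<comment> \<open>Membership in \<open>below\<close> splits into lying in \<open>G t\<close> and
    \<open>t\<close> being a level, as a positive height below some value of \<open>w\<close> is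
    automatically in \<open>T\<close>.\<close>
  have ind: "k t x * indicator below (t, x) = k t x * indicator (G t) x * indicator T t"
    if "x \<in> space \<nu>" for t x
    using that levelsI[OF that, of t] levels_pos[of t] by (auto simp: indicator_def level_set_def)
  have F: "F t * indicator T t = (\<integral>\<^sup>+x. k t x * indicator below (t, x) \<partial>\<nu>)" for t
  proof (cases "t \<in> T")
    case True
    have "(\<integral>\<^sup>+x. \<integral>\<^sup>+y. g x y \<partial>H t x \<partial>\<nu>\<^sub>t t) = (\<integral>\<^sup>+x. k t x \<partial>\<nu>\<^sub>t t)"
      using levels_pos[OF True]
      by (intro nn_integral_cong)
        (auto simp: k_def space_\<nu>\<^sub>t level_set_def intro!: nn_integral_slice[symmetric] gx)
    then have "F t = (\<integral>\<^sup>+x. k t x * indicator (G t) x \<partial>\<nu>)"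
      unfolding F_def by (simp add: nn_integral_\<nu>\<^sub>t[OF True k1])
    also have "\<dots> = (\<integral>\<^sup>+x. k t x * indicator below (t, x) \<partial>\<nu>)"
      using True by (intro nn_integral_cong) (simp add: ind)
    finally show ?thesis using True by simp
  next
    case False
    then have "(\<integral>\<^sup>+x. k t x * indicator below (t, x) \<partial>\<nu>) = (\<integral>\<^sup>+x. 0 \<partial>\<nu>)"
      by (intro nn_integral_cong) (simp add: ind)
    with False show ?thesis by simp
  qed
  show "(\<lambda>t. F t * indicator T t) \<in> borel_measurable borel"
    unfolding F by measurable
  have "(\<integral>\<^sup>+x. \<integral>\<^sup>+y. g x y \<partial>hybrid_slice \<nu> w H x \<partial>\<pi>)
      = (\<integral>\<^sup>+x. ennreal (w x) * (\<integral>\<^sup>+y. g x y \<partial>hybrid_slice \<nu> w H x) \<partial>\<nu>) / ennreal c"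
    by (intro nn_integral_\<pi> nn_integral_measurable_subprob_algebra2[OF g]
        measurable_prob_algebraD hybrid_measurable)
  also have "(\<integral>\<^sup>+x. ennreal (w x) * (\<integral>\<^sup>+y. g x y \<partial>hybrid_slice \<nu> w H x) \<partial>\<nu>)
      = (\<integral>\<^sup>+x. \<integral>\<^sup>+t. k t x * indicator below (t, x) \<partial>lborel \<partial>\<nu>)"
  proof (rule nn_integral_cong)
    fix x assume x: "x \<in> space \<nu>"
    have "(\<integral>\<^sup>+t\<in>{0<..<w x}. k t x \<partial>lborel) = (\<integral>\<^sup>+t. k t x * indicator below (t, x) \<partial>lborel)"
      using x by (intro nn_integral_cong) (auto simp: indicator_def)
    then show "ennreal (w x) * (\<integral>\<^sup>+y. g x y \<partial>hybrid_slice \<nu> w H x)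
        = (\<integral>\<^sup>+t. k t x * indicator below (t, x) \<partial>lborel)"
      using w_pos[OF x]
      by (simp add: nn_integral_hybrid[OF x gx[OF x]] k_def ennreal_times_divide
          mult.commute[of "ennreal (w x)"] ennreal_mult_divide_eq)
  qed
  also have "\<dots> = (\<integral>\<^sup>+t. \<integral>\<^sup>+x. k t x * indicator below (t, x) \<partial>\<nu> \<partial>lborel)"
    using lb.Fubini[of "\<lambda>(t, x). k t x * indicator below (t, x)"] by simp
  finally show "(\<integral>\<^sup>+x. \<integral>\<^sup>+y. g x y \<partial>hybrid_slice \<nu> w H x \<partial>\<pi>) = (\<integral>\<^sup>+t\<in>T. F t \<partial>lborel) / ennreal c"
    by (simp add: F)
qed

text \<open>Decompose over the levels, replace \<open>g y\<close> by \<open>g x\<close> on each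
  level by invariance of \<open>\<nu>\<^sub>t t\<close> under \<open>H t\<close>, and reassemble
  with the same decomposition.\<close>

lemma hybrid_invariant:
  assumes g [measurable]: "g \<in> borel_measurable \<pi>"
  shows "(\<integral>\<^sup>+x. \<integral>\<^sup>+y. g y \<partial>hybrid_slice \<nu> w H x \<partial>\<pi>) = (\<integral>\<^sup>+x. g x \<partial>\<pi>)"
proof -
  have [measurable]: "g \<in> borel_measurable \<nu>"
    using g by (simp add: measurable_\<pi>)
  have H: "(\<integral>\<^sup>+x. \<integral>\<^sup>+y. g y \<partial>H t x \<partial>\<nu>\<^sub>t t) = (\<integral>\<^sup>+x. \<integral>\<^sup>+y. g x \<partial>H t x \<partial>\<nu>\<^sub>t t)" if "t \<in> T" for t
  proof -
    have "(\<integral>\<^sup>+x. \<integral>\<^sup>+y. g x \<partial>H t x \<partial>\<nu>\<^sub>t t) = (\<integral>\<^sup>+x. g x \<partial>\<nu>\<^sub>t t)"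
      by (intro nn_integral_cong)
        (simp add: prob_space.emeasure_space_1[OF markov_kernel_at(1)[OF markov_level[OF that]]])
    then show ?thesis
      by (simp add: reversible_imp_invariant[OF reversible[OF that]] measurable_\<nu>\<^sub>t)
  qed
  have "(\<integral>\<^sup>+x. \<integral>\<^sup>+y. g y \<partial>hybrid_slice \<nu> w H x \<partial>\<pi>)
      = (\<integral>\<^sup>+t\<in>T. ennreal (m t) * (\<integral>\<^sup>+x. \<integral>\<^sup>+y. g y \<partial>H t x \<partial>\<nu>\<^sub>t t) \<partial>lborel) / ennreal c"
    by (rule nn_integral_hybrid_joint(1)) measurable
  also have "(\<integral>\<^sup>+t\<in>T. ennreal (m t) * (\<integral>\<^sup>+x. \<integral>\<^sup>+y. g y \<partial>H t x \<partial>\<nu>\<^sub>t t) \<partial>lborel)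
      = (\<integral>\<^sup>+t\<in>T. ennreal (m t) * (\<integral>\<^sup>+x. \<integral>\<^sup>+y. g x \<partial>H t x \<partial>\<nu>\<^sub>t t) \<partial>lborel)"
    by (intro nn_integral_cong) (auto simp: indicator_def H)
  also have "\<dots> / ennreal c = (\<integral>\<^sup>+x. \<integral>\<^sup>+y. g x \<partial>hybrid_slice \<nu> w H x \<partial>\<pi>)"
    by (rule nn_integral_hybrid_joint(1)[symmetric]) measurable
  also have "\<dots> = (\<integral>\<^sup>+x. g x \<partial>\<pi>)"
    by (intro nn_integral_cong)
      (simp add: prob_space.emeasure_space_1[OF markov_kernel_at(1)[OF markov_hybrid]])
  finally show ?thesis .
qed

lemma dirichlet_hybrid_nonneg: "f \<in> L2 \<pi> \<Longrightarrow> 0 \<le> dirichlet_form \<pi> (hybrid_slice \<nu> w H) f"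
  by (rule dirichlet_form_invariant_kernel(1)[OF prob_space_\<pi> markov_hybrid hybrid_invariant])

lemma dirichlet_level_nonneg:
  "t \<in> T \<Longrightarrow> f \<in> L2 \<pi> \<Longrightarrow> 0 \<le> dirichlet_form (\<nu>\<^sub>t t) (H t) f"
  by (rule dirichlet_form_invariant_kernel(1)[OF prob_space_\<nu>\<^sub>t markov_level
        reversible_imp_invariant[OF reversible] L2_\<nu>\<^sub>t])

text \<open>The energy formula is used for \<pi> and for every \<open>\<nu>\<^sub>t t\<close>, with
  the level decomposition in between. The integrand is half of the one in that decomposition, which
  also yields its measurability.\<close>

lemma dirichlet_hybrid:
  assumes f: "f \<in> L2 \<pi>"
  shows "ennreal (dirichlet_form \<pi> (hybrid_slice \<nu> w H) f)
      = (\<integral>\<^sup>+t\<in>T. ennreal (m t * dirichlet_form (\<nu>\<^sub>t t) (H t) f) \<partial>lborel) / ennreal c"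
    and "(\<lambda>t. ennreal (m t * dirichlet_form (\<nu>\<^sub>t t) (H t) f) * indicator T t) \<in> borel_measurable borel"
proof -
  have [measurable]: "f \<in> borel_measurable \<nu>"
    using f by (simp add: L2_def measurable_\<pi>)
  let ?F = "\<lambda>t. ennreal (m t) * (\<integral>\<^sup>+x. \<integral>\<^sup>+y. ennreal ((f x - f y)\<^sup>2) \<partial>H t x \<partial>\<nu>\<^sub>t t)"
  have g: "(\<lambda>(x, y). ennreal ((f x - f y)\<^sup>2)) \<in> borel_measurable (\<nu> \<Otimes>\<^sub>M \<nu>)"
    by measurable
  note joint = nn_integral_hybrid_joint[OF g]
  have half: "ennreal (m t * dirichlet_form (\<nu>\<^sub>t t) (H t) f) * indicator T t = ?F t * indicator T t / 2" for t
  proof (cases "t \<in> T")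
    case True
    have "ennreal (dirichlet_form (\<nu>\<^sub>t t) (H t) f)
        = (\<integral>\<^sup>+x. \<integral>\<^sup>+y. ennreal ((f x - f y)\<^sup>2) \<partial>H t x \<partial>\<nu>\<^sub>t t) / 2"
      by (rule dirichlet_form_invariant_kernel(2)[OF prob_space_\<nu>\<^sub>t[OF True] markov_level[OF True]
            reversible_imp_invariant[OF reversible[OF True]] L2_\<nu>\<^sub>t[OF True f]])
    then show ?thesis
      using True emeasure_level_set(2)[OF True]
      by (simp add: ennreal_mult'' dirichlet_level_nonneg f ennreal_times_divide)
  qed simp
  show "(\<lambda>t. ennreal (m t * dirichlet_form (\<nu>\<^sub>t t) (H t) f) * indicator T t) \<in> borel_measurable borel"
    unfolding half using joint(2) by measurable
  have "ennreal (dirichlet_form \<pi> (hybrid_slice \<nu> w H) f) = (\<integral>\<^sup>+t\<in>T. ?F t \<partial>lborel) / ennreal c / 2"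
    unfolding joint(1)[symmetric]
    by (rule dirichlet_form_invariant_kernel(2)[OF prob_space_\<pi> markov_hybrid hybrid_invariant f])
  also have "\<dots> = (\<integral>\<^sup>+t\<in>T. ?F t \<partial>lborel) / 2 / ennreal c"
    by (simp add: divide_ennreal_def mult_ac)
  also have "(\<integral>\<^sup>+t\<in>T. ?F t \<partial>lborel) / 2 = (\<integral>\<^sup>+t. ?F t * indicator T t / 2 \<partial>lborel)"
    using joint(2) by (intro nn_integral_divide[symmetric]) simp
  finally show "ennreal (dirichlet_form \<pi> (hybrid_slice \<nu> w H) f)
      = (\<integral>\<^sup>+t\<in>T. ennreal (m t * dirichlet_form (\<nu>\<^sub>t t) (H t) f) \<partial>lborel) / ennreal c"
    unfolding half .
qed

end

subsection \<open>Ideal slice sampling\<close>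

context slice_target
begin

lemma emeasure_\<nu>\<^sub>t_Int:
  assumes [measurable]: "A \<in> sets \<nu>"
  shows "emeasure (\<nu>\<^sub>t t) (A \<inter> G t) = emeasure \<nu> (A \<inter> G t) / emeasure \<nu> (G t)"
    and "emeasure (level_uniform \<nu> w t) A = emeasure \<nu> (A \<inter> G t) / emeasure \<nu> (G t)"
proof -
  have "emeasure (\<nu>\<^sub>t t) (A \<inter> G t) = emeasure (level_uniform \<nu> w t) (A \<inter> G t)"
    unfolding level_uniform_on_def
    by (intro emeasure_restrict_space) (auto simp: level_uniform_def)
  then show "emeasure (\<nu>\<^sub>t t) (A \<inter> G t) = emeasure \<nu> (A \<inter> G t) / emeasure \<nu> (G t)"
    by (simp add: level_uniform_def Int_ac)
  show "emeasure (level_uniform \<nu> w t) A = emeasure \<nu> (A \<inter> G t) / emeasure \<nu> (G t)"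
    by (simp add: level_uniform_def Int_commute)
qed

lemma emeasure_level_measurable:
  assumes [measurable]: "A \<in> sets \<nu>"
  shows "(\<lambda>t. emeasure \<nu> (A \<inter> G t)) \<in> borel_measurable borel"
proof -
  have "(\<lambda>t. \<integral>\<^sup>+x. (if t < w x then indicator A x else 0) \<partial>\<nu>) \<in> borel_measurable borel"
    by measurable
  also have "(\<lambda>t. \<integral>\<^sup>+x. (if t < w x then indicator A x else 0) \<partial>\<nu>)
      = (\<lambda>t. \<integral>\<^sup>+x. indicator (A \<inter> G t) x \<partial>\<nu>)"
    by (intro ext nn_integral_cong) (auto simp: indicator_def level_set_def)
  also have "\<dots> = (\<lambda>t. emeasure \<nu> (A \<inter> G t))"
    by simp
  finally show ?thesis .
qed

lemma level_mass_measurable [measurable]: "m \<in> borel_measurable borel"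
proof -
  have "(\<lambda>t. enn2real (emeasure \<nu> (space \<nu> \<inter> G t))) \<in> borel_measurable borel"
    using emeasure_level_measurable[OF sets.top] by measurable
  also have "(\<lambda>t. enn2real (emeasure \<nu> (space \<nu> \<inter> G t))) = m"
    using sets.sets_into_space[OF level_set_measurable]
    by (auto simp: fun_eq_iff level_mass_def measure_def Int_absorb1)
  finally show ?thesis .
qed

lemma slice_kernel_ideal: "slice_kernel \<nu> w (\<lambda>t x. \<nu>\<^sub>t t)"
proof unfold_locales
  fix t assume "t \<in> T"
  then interpret prob_space "\<nu>\<^sub>t t" by (rule prob_space_\<nu>\<^sub>t)
  show "reversible (\<nu>\<^sub>t t) (\<lambda>x. \<nu>\<^sub>t t)" by (rule reversible_const)
next
  have "(\<lambda>(t, x). emeasure (\<nu>\<^sub>t t) (A \<inter> G t)) \<in> borel_measurable (restrict_space (borel \<Otimes>\<^sub>M \<nu>) S)"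
    if A: "A \<in> sets \<nu>" for A S
  proof (rule measurable_restrict_space1)
    have "(\<lambda>t. emeasure \<nu> (A \<inter> G t) / emeasure \<nu> (space \<nu> \<inter> G t)) \<in> borel_measurable borel"
      using emeasure_level_measurable[OF A] emeasure_level_measurable[OF sets.top] by measurable
    then have "(\<lambda>t. emeasure (\<nu>\<^sub>t t) (A \<inter> G t)) \<in> borel_measurable borel"
      using sets.sets_into_space[OF level_set_measurable]
      by (simp add: emeasure_\<nu>\<^sub>t_Int[OF A] Int_absorb1)
    from measurable_compose[OF measurable_fst this]
    show "(\<lambda>(t, x). emeasure (\<nu>\<^sub>t t) (A \<inter> G t)) \<in> borel_measurable (borel \<Otimes>\<^sub>M \<nu>)"
      by (simp add: split_beta')
  qed
  then show "measurable_family \<nu> w (\<lambda>t x. \<nu>\<^sub>t t)"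
    by (simp add: measurable_family_def)
qed

sublocale ideal: slice_kernel \<nu> w "\<lambda>t x. \<nu>\<^sub>t t"
  by (rule slice_kernel_ideal)

text \<open>For every \<open>t\<close>, \<open>level_uniform\<close> on \<open>A\<close> and
  \<open>\<nu>\<^sub>t t\<close> on \<open>A \<inter> G t\<close> are the same quotient of
  \<nu>-measures, so the defining integrands coincide. All results on hybrid samplers thus apply to
  the ideal one.\<close>

lemma ideal_slice_eq: "ideal_slice \<nu> w = hybrid_slice \<nu> w (\<lambda>t x. \<nu>\<^sub>t t)"
  unfolding ideal_slice_def hybrid_slice_def
  by (intro ext measure_of_eq sets.space_closed) (simp add: sets.sigma_sets_eq emeasure_\<nu>\<^sub>t_Int)

text \<open>The layer cake formula, read off from the level decomposition with the constant function
  1.\<close>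

lemma level_mass_nn_integral: "(\<integral>\<^sup>+t\<in>T. ennreal (m t) \<partial>lborel) = ennreal c"
proof -
  have "(\<integral>\<^sup>+x. \<integral>\<^sup>+y. 1 \<partial>hybrid_slice \<nu> w (\<lambda>t x. \<nu>\<^sub>t t) x \<partial>\<pi>)
      = (\<integral>\<^sup>+t\<in>T. ennreal (m t) * (\<integral>\<^sup>+x. \<integral>\<^sup>+y. 1 \<partial>\<nu>\<^sub>t t \<partial>\<nu>\<^sub>t t) \<partial>lborel) / ennreal c"
    by (rule ideal.nn_integral_hybrid_joint(1)) measurable
  also have "(\<integral>\<^sup>+t\<in>T. ennreal (m t) * (\<integral>\<^sup>+x. \<integral>\<^sup>+y. 1 \<partial>\<nu>\<^sub>t t \<partial>\<nu>\<^sub>t t) \<partial>lborel)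
      = (\<integral>\<^sup>+t\<in>T. ennreal (m t) \<partial>lborel)"
    by (intro nn_integral_cong)
      (auto simp: indicator_def prob_space.emeasure_space_1[OF prob_space_\<nu>\<^sub>t])
  also have "(\<integral>\<^sup>+x. \<integral>\<^sup>+y. 1 \<partial>hybrid_slice \<nu> w (\<lambda>t x. \<nu>\<^sub>t t) x \<partial>\<pi>) = (\<integral>\<^sup>+x. 1 \<partial>\<pi>)"
    by (rule ideal.hybrid_invariant) simp
  finally have "(\<integral>\<^sup>+t\<in>T. ennreal (m t) \<partial>lborel) / ennreal c = 1"
    by (simp add: prob_space.emeasure_space_1[OF prob_space_\<pi>])
  then show ?thesis
    using w_integral_pos by (simp add: divide_eq_1_ennreal)
qed

lemma level_mass_integrable: "set_integrable lborel T m"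
proof -
  have "(\<integral>\<^sup>+t. ennreal (norm (indicator T t *\<^sub>R m t)) \<partial>lborel) = (\<integral>\<^sup>+t\<in>T. ennreal (m t) \<partial>lborel)"
    by (intro nn_integral_cong) (auto simp: indicator_def level_mass_def)
  then show ?thesis
    unfolding set_integrable_def integrable_iff_bounded
    by (simp add: level_mass_nn_integral)
qed

text \<open>The constant kernel maps a function to its mean, hence a centred function to 0, and only
  the squared norm of \<open>g\<close> remains.\<close>

lemma dirichlet_ideal_level:
  assumes t: "t \<in> T" and f: "f \<in> L2 \<pi>"
  defines "g \<equiv> \<lambda>x. f x - (\<integral>y. f y \<partial>\<nu>\<^sub>t t)"
  shows "dirichlet_form (\<nu>\<^sub>t t) (\<lambda>x. \<nu>\<^sub>t t) f = L2_inner (\<nu>\<^sub>t t) g g"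
    and "g \<in> L2_0 (\<nu>\<^sub>t t)"
proof -
  interpret prob_space "\<nu>\<^sub>t t" by (rule prob_space_\<nu>\<^sub>t[OF t])
  note ft = L2_\<nu>\<^sub>t[OF t f]
  have "integrable (\<nu>\<^sub>t t) f"
    using ft square_integrable_imp_integrable by (auto simp: L2_def)
  then have mean: "(\<integral>x. g x \<partial>\<nu>\<^sub>t t) = 0"
    by (simp add: g_def prob_space)
  then show "g \<in> L2_0 (\<nu>\<^sub>t t)"
    using L2_diff_const[OF ft] by (simp add: L2_0_def g_def)
  have "dirichlet_form (\<nu>\<^sub>t t) (\<lambda>x. \<nu>\<^sub>t t) f = dirichlet_form (\<nu>\<^sub>t t) (\<lambda>x. \<nu>\<^sub>t t) g"
    unfolding g_def
    by (rule dirichlet_form_diff_const[symmetric, OF prob_space_axioms reversible_const ft])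
  also have "\<dots> = L2_inner (\<nu>\<^sub>t t) g g"
    by (simp add: dirichlet_form_def kernel_op_def mean)
  finally show "dirichlet_form (\<nu>\<^sub>t t) (\<lambda>x. \<nu>\<^sub>t t) f = L2_inner (\<nu>\<^sub>t t) g g" .
qed

end

subsection \<open>Comparison of the two samplers\<close>

context slice_kernel
begin

text \<open>After centring, the two forms differ by the inner product of
  \<open>kernel_op (H t) g\<close> with \<open>g\<close>, which positivity makes
  nonnegative.\<close>

lemma dirichlet_level_le_ideal:
  assumes t: "t \<in> T" and pos: "positive_kernel (\<nu>\<^sub>t t) (H t)" and f: "f \<in> L2 \<pi>"
  shows "dirichlet_form (\<nu>\<^sub>t t) (H t) f \<le> dirichlet_form (\<nu>\<^sub>t t) (\<lambda>x. \<nu>\<^sub>t t) f"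
proof -
  define g where "g x = f x - (\<integral>y. f y \<partial>\<nu>\<^sub>t t)" for x
  note ideal = dirichlet_ideal_level[OF t f, folded g_def]
  then have g: "g \<in> L2 (\<nu>\<^sub>t t)"
    by (simp add: L2_0_def)
  have "dirichlet_form (\<nu>\<^sub>t t) (H t) f = dirichlet_form (\<nu>\<^sub>t t) (H t) g"
    unfolding g_def
    by (rule dirichlet_form_diff_const[symmetric, OF prob_space_\<nu>\<^sub>t[OF t] reversible[OF t] L2_\<nu>\<^sub>t[OF t f]])
  also have "\<dots> = L2_inner (\<nu>\<^sub>t t) g g - L2_inner (\<nu>\<^sub>t t) (kernel_op (H t) g) g"
    by (rule dirichlet_form_invariant_kernel(3)[OF prob_space_\<nu>\<^sub>t[OF t] markov_level[OF t]
          reversible_imp_invariant[OF reversible[OF t]] g])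
  also have "\<dots> \<le> L2_inner (\<nu>\<^sub>t t) g g"
    using pos g by (simp add: positive_kernel_def)
  finally show ?thesis by (simp add: ideal(1))
qed

lemma dirichlet_hybrid_le_ideal:
  assumes pos: "\<And>t. t \<in> T \<Longrightarrow> positive_kernel (\<nu>\<^sub>t t) (H t)" and f: "f \<in> L2 \<pi>"
  shows "dirichlet_form \<pi> (hybrid_slice \<nu> w H) f \<le> dirichlet_form \<pi> (ideal_slice \<nu> w) f"
proof -
  have "ennreal (dirichlet_form \<pi> (hybrid_slice \<nu> w H) f) \<le> ennreal (dirichlet_form \<pi> (ideal_slice \<nu> w) f)"
    unfolding dirichlet_hybrid(1)[OF f] ideal_slice_eq ideal.dirichlet_hybrid(1)[OF f]
    by (intro divide_right_mono_ennreal nn_integral_mono)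
      (auto simp: indicator_def level_mass_def intro!: ennreal_leI mult_left_mono
        dirichlet_level_le_ideal pos f)
  then show ?thesis
    by (simp add: ideal_slice_eq ideal.dirichlet_hybrid_nonneg f)
qed

section \<open>Almost sure bounds and oscillation on the levels\<close>

lemma AE_\<nu>\<^sub>t:
  assumes t: "t \<in> T" and P: "AE x in \<pi>. P x"
  shows "AE x in \<nu>\<^sub>t t. P x"
proof -
  have "AE x in \<nu>. 0 < ennreal (w x / c) \<longrightarrow> P x"
    using P unfolding target_measure_def by (subst (asm) AE_density) auto
  \<comment> \<open>As \<open>w\<close> is positive everywhere, null sets of \<pi> are null sets of
    \<nu>.\<close>
  then have "AE x in \<nu>. P x"
    using AE_space by eventually_elim (use w_pos w_integral_pos in auto)
  then have "AE x in level_uniform \<nu> w t. P x"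
    unfolding level_uniform_def using emeasure_level_set[OF t]
    by (intro AE_uniform_measureI) auto
  then show ?thesis
    unfolding level_uniform_on_def
    by (subst AE_restrict_space_iff) (auto simp: level_uniform_def)
qed

lemma osc_norm_level_le:
  assumes t: "t \<in> T" and f: "f \<in> L2 \<pi>" and fin: "osc_norm \<pi> f = ereal r"
  shows "osc_norm (\<nu>\<^sub>t t) (\<lambda>x. f x - a) \<le> ereal r"
proof -
  have [measurable]: "f \<in> borel_measurable (\<nu>\<^sub>t t)"
    using L2_\<nu>\<^sub>t[OF t f] by (simp add: L2_def)
  obtain lo hi where hi: "esssup \<pi> (\<lambda>x. ereal (f x)) = ereal hi"
    and lo: "essinf \<pi> (\<lambda>x. ereal (f x)) = ereal lo" and r: "r = hi - lo"
    using fin unfolding osc_norm_def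
    by (cases "esssup \<pi> (\<lambda>x. ereal (f x))"; cases "essinf \<pi> (\<lambda>x. ereal (f x))") auto
  have "AE x in \<pi>. lo \<le> f x" "AE x in \<pi>. f x \<le> hi"
    using essinf_le_AE[of \<pi> "\<lambda>x. ereal (f x)"] esssup_AE[of "\<lambda>x. ereal (f x)" \<pi>]
    by (simp_all add: lo hi)
  then show ?thesis
    unfolding r by (intro osc_norm_diff_le AE_\<nu>\<^sub>t[OF t]) auto
qed

text \<open>An infinite oscillation is harmless on levels with \<open>b s = 0\<close>, where \<open>0 * \<infinity> = 0\<close>.\<close>

lemma dirichlet_ideal_level_le:
  assumes t: "t \<in> T" and wpi: "weak_poincare (\<nu>\<^sub>t t) (H t) b" and s: "0 < s" and f: "f \<in> L2 \<pi>"
    and r: "b s = 0 \<or> osc_norm \<pi> f = ereal r"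
  shows "dirichlet_form (\<nu>\<^sub>t t) (\<lambda>x. \<nu>\<^sub>t t) f \<le> s * dirichlet_form (\<nu>\<^sub>t t) (H t) f + b s * r\<^sup>2"
proof -
  interpret t: prob_space "\<nu>\<^sub>t t" by (rule prob_space_\<nu>\<^sub>t[OF t])
  define g where "g x = f x - (\<integral>y. f y \<partial>\<nu>\<^sub>t t)" for x
  note ideal = dirichlet_ideal_level[OF t f, folded g_def]
  have "dirichlet_form (\<nu>\<^sub>t t) (H t) g = dirichlet_form (\<nu>\<^sub>t t) (H t) f"
    unfolding g_def
    by (rule dirichlet_form_diff_const[OF t.prob_space_axioms reversible[OF t] L2_\<nu>\<^sub>t[OF t f]])
  then have "ereal (dirichlet_form (\<nu>\<^sub>t t) (\<lambda>x. \<nu>\<^sub>t t) f)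
      \<le> ereal (s * dirichlet_form (\<nu>\<^sub>t t) (H t) f) + ereal (b s) * (osc_norm (\<nu>\<^sub>t t) g)\<^sup>2"
    using wpi s ideal(2) unfolding weak_poincare_def ideal(1) by metis
  also have "\<dots> \<le> ereal (s * dirichlet_form (\<nu>\<^sub>t t) (H t) f) + ereal (b s * r\<^sup>2)"
  proof (cases "b s = 0")
    case False
    then have le: "osc_norm (\<nu>\<^sub>t t) g \<le> ereal r"
      using r unfolding g_def by (intro osc_norm_level_le[OF t f]) simp
    then have "(osc_norm (\<nu>\<^sub>t t) g)\<^sup>2 \<le> (ereal r)\<^sup>2"
      unfolding power2_eq_square
      using t.osc_norm_nonneg[of g] order_trans[OF t.osc_norm_nonneg le]
      by (intro ereal_mult_mono) auto
    then have "ereal (b s) * (osc_norm (\<nu>\<^sub>t t) g)\<^sup>2 \<le> ereal (b s) * (ereal r)\<^sup>2"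
      using wpi s by (intro ereal_mult_left_mono) (auto simp: weak_poincare_def)
    then show ?thesis
      by (intro add_left_mono) simp
  qed (simp add: zero_ereal_def[symmetric])
  finally show ?thesis by simp
qed

end

section \<open>Averaging the weak Poincare rates over the levels\<close>

locale slice_rate = slice_kernel +
  fixes \<beta>\<^sub>0 :: "real \<Rightarrow> real \<Rightarrow> real"
  assumes rate_measurable: "(\<lambda>(s, t). \<beta>\<^sub>0 s t)
        \<in> borel_measurable (restrict_space (borel \<Otimes>\<^sub>M borel) ({0<..} \<times> T))"
    and rate_bound: "\<And>s t. 0 < s \<Longrightarrow> t \<in> T \<Longrightarrow> \<beta>\<^sub>0 s t \<in> {0..1/4}"
    and rate_wpi: "AE t in lborel. t \<in> T \<longrightarrow> weak_poincare (\<nu>\<^sub>t t) (H t) (\<lambda>s. \<beta>\<^sub>0 s t)"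
begin

text \<open>The indicator discards the values of \<open>\<beta>\<^sub>0 s\<close> off
  \<open>T\<close>, about which nothing is assumed, and extends the integrand by 0 to the real
  line.\<close>

abbreviation "\<phi> s t \<equiv> indicator T t * (\<beta>\<^sub>0 s t * m t)"

lemma averaged_rate_eq: "averaged_rate \<nu> w \<beta>\<^sub>0 s = (\<integral>t. \<phi> s t \<partial>lborel) / c"
  by (simp add: averaged_rate_def set_lebesgue_integral_def)

lemma rate_section_measurable:
  assumes "0 < s" shows "\<phi> s \<in> borel_measurable borel"
proof -
  have "(\<lambda>t. (s, t)) \<in> restrict_space borel T \<rightarrow>\<^sub>M restrict_space (borel \<Otimes>\<^sub>M borel) ({0<..} \<times> T)"
    using assms by (intro measurable_restrict_space2 measurable_restrict_space1)
      (auto simp: space_restrict_space)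
  from measurable_compose[OF this rate_measurable]
  have "(\<lambda>t. \<beta>\<^sub>0 s t) \<in> borel_measurable (restrict_space borel T)"
    by simp
  then have "(\<lambda>t. \<beta>\<^sub>0 s t * m t) \<in> borel_measurable (restrict_space borel T)"
    by (rule borel_measurable_times[OF _ measurable_restrict_space1[OF level_mass_measurable]])
  then show ?thesis
    by (subst (asm) borel_measurable_restrict_space_iff) auto
qed

lemma rate_nonneg: "0 < s \<Longrightarrow> 0 \<le> \<phi> s t"
  using rate_bound[of s t] by (auto simp: indicator_def level_mass_def)

text \<open>As \<open>\<beta>\<^sub>0 s t \<le> 1\<close>, the level mass is a majorant independent
  of \<open>s\<close>; it serves both integrability and dominated convergence.\<close>

lemma rate_norm_le: "0 < s \<Longrightarrow> norm (\<phi> s t) \<le> indicator T t *\<^sub>R m t"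
  using rate_bound[of s t] mult_right_mono[of "\<beta>\<^sub>0 s t" 1 "m t"]
  by (auto simp: indicator_def level_mass_def abs_mult)

lemma rate_integrable:
  assumes "0 < s" shows "integrable lborel (\<phi> s)"
  by (rule Bochner_Integration.integrable_bound[OF level_mass_integrable[unfolded set_integrable_def]])
    (use rate_section_measurable[OF assms] rate_norm_le[OF assms] in \<open>auto simp: abs_mult level_mass_def\<close>)

lemma averaged_rate_nonneg: "0 < s \<Longrightarrow> 0 \<le> averaged_rate \<nu> w \<beta>\<^sub>0 s"
  unfolding averaged_rate_eq using w_integral_pos rate_nonneg
  by (intro divide_nonneg_pos Bochner_Integration.integral_nonneg) auto

lemma antimono_averaged_rate: "antimono_on {0<..} (averaged_rate \<nu> w \<beta>\<^sub>0)"
proof (rule monotone_onI)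
  fix s s' :: real assume s: "s \<in> {0<..}" "s' \<in> {0<..}" "s \<le> s'"
  have "AE t in lborel. \<phi> s' t \<le> \<phi> s t"
    using rate_wpi
  proof eventually_elim
    case (elim t)
    show ?case
    proof (cases "t \<in> T")
      case True
      then have "antimono_on {0<..} (\<lambda>s. \<beta>\<^sub>0 s t)"
        using elim by (simp add: weak_poincare_def)
      then have "\<beta>\<^sub>0 s' t \<le> \<beta>\<^sub>0 s t"
        using s monotone_onD[of "{0<..}" _ _ "\<lambda>s. \<beta>\<^sub>0 s t" s s'] by simp
      then show ?thesis
        by (simp add: level_mass_def mult_right_mono indicator_def)
    qed simp
  qed
  then have "(\<integral>t. \<phi> s' t \<partial>lborel) \<le> (\<integral>t. \<phi> s t \<partial>lborel)"
    using s by (intro integral_mono_AE rate_integrable) auto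
  then show "averaged_rate \<nu> w \<beta>\<^sub>0 s \<ge> averaged_rate \<nu> w \<beta>\<^sub>0 s'"
    unfolding averaged_rate_eq using w_integral_pos by (intro divide_right_mono) auto
qed

lemma averaged_rate_tendsto: "(averaged_rate \<nu> w \<beta>\<^sub>0 \<longlongrightarrow> 0) at_top"
proof -
  \<comment> \<open>Replacing \<open>s\<close> by \<open>max 1 s\<close> keeps the argument positive
    for every real \<open>s\<close>, so that measurability and the majorant hold throughout; nothing
    changes for \<open>s \<ge> 1\<close>.\<close>
  have "((\<lambda>s. \<integral>t. \<phi> (max 1 s) t \<partial>lborel) \<longlongrightarrow> (\<integral>t. 0 \<partial>(lborel :: real measure))) at_top"
  proof (rule integral_dominated_convergence_at_top)
    show "\<phi> (max 1 s) \<in> borel_measurable lborel" for s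
      using rate_section_measurable[of "max 1 s"] by simp
    show "integrable lborel (\<lambda>t. indicator T t *\<^sub>R m t)"
      using level_mass_integrable by (simp add: set_integrable_def)
    show "\<forall>\<^sub>F s in at_top. AE t in lborel. norm (\<phi> (max 1 s) t) \<le> indicator T t *\<^sub>R m t"
      using rate_norm_le by (intro always_eventually allI AE_I2) simp
    show "AE t in lborel. ((\<lambda>s. \<phi> (max 1 s) t) \<longlongrightarrow> 0) at_top"
      using rate_wpi
    proof eventually_elim
      case (elim t)
      show ?case
      proof (cases "t \<in> T")
        case True
        then have "((\<lambda>s. \<beta>\<^sub>0 s t) \<longlongrightarrow> 0) at_top"
          using elim by (simp add: weak_poincare_def)
        moreover have "filterlim (\<lambda>s::real. max 1 s) at_top at_top"
          by (rule filterlim_at_top_mono[OF filterlim_ident]) simp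
        ultimately have "((\<lambda>s. \<beta>\<^sub>0 (max 1 s) t) \<longlongrightarrow> 0) at_top"
          by (rule filterlim_compose)
        then have "((\<lambda>s. \<beta>\<^sub>0 (max 1 s) t * m t) \<longlongrightarrow> 0 * m t) at_top"
          by (intro tendsto_mult tendsto_const)
        with True show ?thesis by simp
      qed simp
    qed
  qed simp
  then have "((\<lambda>s. averaged_rate \<nu> w \<beta>\<^sub>0 (max 1 s)) \<longlongrightarrow> 0) at_top"
    unfolding averaged_rate_eq by (intro tendsto_divide_zero) simp
  moreover have "\<forall>\<^sub>F s in at_top. averaged_rate \<nu> w \<beta>\<^sub>0 (max 1 s) = averaged_rate \<nu> w \<beta>\<^sub>0 s"
    using eventually_ge_at_top[of 1] by eventually_elim simp
  ultimately show ?thesis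
    by (rule Lim_transform_eventually)
qed

lemma nn_integral_rate:
  assumes "0 < s"
  shows "(\<integral>\<^sup>+t. ennreal (\<phi> s t) \<partial>lborel) / ennreal c = ennreal (averaged_rate \<nu> w \<beta>\<^sub>0 s)"
  using assms w_integral_pos rate_nonneg[OF assms] unfolding averaged_rate_eq
  by (subst nn_integral_eq_integral[OF rate_integrable])
    (auto intro!: divide_ennreal Bochner_Integration.integral_nonneg)

text \<open>The level inequality integrated over \<open>t\<close>. Here \<open>r\<close> is the
  oscillation if that is finite, and may be any real if the averaged rate vanishes at
  \<open>s\<close>.\<close>

lemma dirichlet_ideal_le:
  assumes s: "0 < s" and f: "f \<in> L2 \<pi>"
    and r: "averaged_rate \<nu> w \<beta>\<^sub>0 s = 0 \<or> osc_norm \<pi> f = ereal r"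
  shows "dirichlet_form \<pi> (ideal_slice \<nu> w) f
    \<le> s * dirichlet_form \<pi> (hybrid_slice \<nu> w H) f + averaged_rate \<nu> w \<beta>\<^sub>0 s * r\<^sup>2"
proof -
  let ?h = "\<lambda>t. ennreal (m t * dirichlet_form (\<nu>\<^sub>t t) (H t) f) * indicator T t"
  \<comment> \<open>If the averaged rate vanishes, so does its nonnegative integrand at almost every
    level. As \<open>m t\<close> is positive on \<open>T\<close>, this gives
    \<open>\<beta>\<^sub>0 s t = 0\<close> there, the other alternative of the level
    inequality.\<close>
  have zero: "AE t in lborel. osc_norm \<pi> f \<noteq> ereal r \<longrightarrow> \<phi> s t = 0"
  proof (cases "osc_norm \<pi> f = ereal r")
    case False
    then have "(\<integral>t. \<phi> s t \<partial>lborel) = 0"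
      using r w_integral_pos by (simp add: averaged_rate_eq)
    then show ?thesis
      using rate_nonneg[OF s] by (subst (asm) integral_nonneg_eq_0_iff_AE[OF rate_integrable[OF s]]) auto
  qed simp
  have "AE t in lborel. ennreal (m t * dirichlet_form (\<nu>\<^sub>t t) (\<lambda>x. \<nu>\<^sub>t t) f) * indicator T t
      \<le> ennreal s * ?h t + ennreal (\<phi> s t) * ennreal (r\<^sup>2)"
    using rate_wpi zero
  proof eventually_elim
    case (elim t)
    show ?case
    proof (cases "t \<in> T")
      case True
      have m: "0 < m t" by (rule emeasure_level_set(2)[OF True])
      have b: "0 \<le> \<beta>\<^sub>0 s t" using rate_bound[OF s True] by simp
      have E: "0 \<le> dirichlet_form (\<nu>\<^sub>t t) (H t) f" by (rule dirichlet_level_nonneg[OF True f])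
      have "\<beta>\<^sub>0 s t = 0 \<or> osc_norm \<pi> f = ereal r"
        using elim(2) True m by auto
      then have "dirichlet_form (\<nu>\<^sub>t t) (\<lambda>x. \<nu>\<^sub>t t) f \<le> s * dirichlet_form (\<nu>\<^sub>t t) (H t) f + \<beta>\<^sub>0 s t * r\<^sup>2"
        using elim(1) True by (intro dirichlet_ideal_level_le[OF True _ s f]) auto
      then have "m t * dirichlet_form (\<nu>\<^sub>t t) (\<lambda>x. \<nu>\<^sub>t t) f
          \<le> m t * (s * dirichlet_form (\<nu>\<^sub>t t) (H t) f + \<beta>\<^sub>0 s t * r\<^sup>2)"
        using m by (intro mult_left_mono) auto
      also have "\<dots> = s * (m t * dirichlet_form (\<nu>\<^sub>t t) (H t) f) + \<phi> s t * r\<^sup>2"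
        using True by (simp add: algebra_simps)
      finally have "ennreal (m t * dirichlet_form (\<nu>\<^sub>t t) (\<lambda>x. \<nu>\<^sub>t t) f)
          \<le> ennreal (s * (m t * dirichlet_form (\<nu>\<^sub>t t) (H t) f) + \<phi> s t * r\<^sup>2)"
        by (rule ennreal_leI)
      also have "\<dots> = ennreal s * ennreal (m t * dirichlet_form (\<nu>\<^sub>t t) (H t) f) + ennreal (\<phi> s t) * ennreal (r\<^sup>2)"
        using s m b E by (simp add: ennreal_plus[symmetric] ennreal_mult[symmetric] del: ennreal_plus)
      finally show ?thesis using True by simp
    qed simp
  qed
  then have "(\<integral>\<^sup>+t\<in>T. ennreal (m t * dirichlet_form (\<nu>\<^sub>t t) (\<lambda>x. \<nu>\<^sub>t t) f) \<partial>lborel)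
      \<le> (\<integral>\<^sup>+t. ennreal s * ?h t + ennreal (\<phi> s t) * ennreal (r\<^sup>2) \<partial>lborel)"
    by (rule nn_integral_mono_AE)
  also have "\<dots> = ennreal s * (\<integral>\<^sup>+t. ?h t \<partial>lborel) + (\<integral>\<^sup>+t. ennreal (\<phi> s t) \<partial>lborel) * ennreal (r\<^sup>2)"
  proof -
    have "?h \<in> borel_measurable lborel" "(\<lambda>t. ennreal (\<phi> s t)) \<in> borel_measurable lborel"
      using dirichlet_hybrid(2)[OF f] rate_section_measurable[OF s] by simp_all
    then show ?thesis
      by (subst nn_integral_add) (simp_all only: nn_integral_cmult nn_integral_multc
        borel_measurable_times_ennreal borel_measurable_const)
  qed
  finally have "ennreal (dirichlet_form \<pi> (ideal_slice \<nu> w) f)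
      \<le> (ennreal s * (\<integral>\<^sup>+t. ?h t \<partial>lborel) + (\<integral>\<^sup>+t. ennreal (\<phi> s t) \<partial>lborel) * ennreal (r\<^sup>2)) / ennreal c"
    unfolding ideal_slice_eq ideal.dirichlet_hybrid(1)[OF f] by (rule divide_right_mono_ennreal)
  also have "\<dots> = ennreal s * ennreal (dirichlet_form \<pi> (hybrid_slice \<nu> w H) f)
      + ennreal (averaged_rate \<nu> w \<beta>\<^sub>0 s) * ennreal (r\<^sup>2)"
    unfolding dirichlet_hybrid(1)[OF f] nn_integral_rate[OF s, symmetric]
    by (simp add: divide_ennreal_def distrib_left mult_ac)
  also have "\<dots> = ennreal (s * dirichlet_form \<pi> (hybrid_slice \<nu> w H) f + averaged_rate \<nu> w \<beta>\<^sub>0 s * r\<^sup>2)"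
    using s averaged_rate_nonneg[OF s] dirichlet_hybrid_nonneg[OF f]
    by (simp add: ennreal_plus[symmetric] ennreal_mult[symmetric] del: ennreal_plus)
  finally show ?thesis
    using s averaged_rate_nonneg[OF s] dirichlet_hybrid_nonneg[OF f]
    by (subst (asm) ennreal_le_iff) auto
qed

text \<open>For infinite oscillation, either the averaged rate is 0 and the product vanishes by
  convention, so that the real inequality with \<open>r = 0\<close> applies, or the right-hand side
  is infinite.\<close>

lemma dirichlet_ideal_le_ereal:
  assumes s: "0 < s" and f: "f \<in> L2 \<pi>"
  shows "ereal (dirichlet_form \<pi> (ideal_slice \<nu> w) f)
    \<le> ereal (s * dirichlet_form \<pi> (hybrid_slice \<nu> w H) f)
      + ereal (averaged_rate \<nu> w \<beta>\<^sub>0 s) * (osc_norm \<pi> f)\<^sup>2"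
proof (cases "osc_norm \<pi> f")
  case (real r)
  then show ?thesis using dirichlet_ideal_le[OF s f, of r] by simp
next
  case PInf
  show ?thesis
  proof (cases "averaged_rate \<nu> w \<beta>\<^sub>0 s = 0")
    case True
    then show ?thesis using dirichlet_ideal_le[OF s f, of 0] by (simp add: zero_ereal_def[symmetric])
  next
    case False
    then show ?thesis
      using PInf averaged_rate_nonneg[OF s] by (simp add: power2_eq_square)
  qed
next
  case MInf
  then show ?thesis using prob_space.osc_norm_nonneg[OF prob_space_\<pi>, of f] by simp
qed

end

theorem theorem12:
  fixes \<nu> :: "'a measure" and w :: "'a \<Rightarrow> real" and H :: "real \<Rightarrow> 'a \<Rightarrow> 'a measure"
  assumes "sigma_finite_measure \<nu>"
    and "w \<in> borel_measurable \<nu>"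
    and "\<And>x. x \<in> space \<nu> \<Longrightarrow> 0 < w x"
    and "integrable \<nu> w" and "0 < (\<integral>x. w x \<partial>\<nu>)"
    and "(SUP x\<in>space \<nu>. ereal (w x)) = esssup \<nu> (\<lambda>x. ereal (w x))"
    and "\<And>t. t \<in> levels \<nu> w \<Longrightarrow> reversible (level_uniform_on \<nu> w t) (H t)"
    and "measurable_family \<nu> w H"
    and "\<And>t. t \<in> levels \<nu> w \<Longrightarrow> positive_kernel (level_uniform_on \<nu> w t) (H t)"
  shows
    "(\<forall>f \<in> L2_0 (target_measure \<nu> w).
        dirichlet_form (target_measure \<nu> w) (hybrid_slice \<nu> w H) f
          \<le> dirichlet_form (target_measure \<nu> w) (ideal_slice \<nu> w) f)
     \<and>
     (\<forall>\<beta>\<^sub>0 :: real \<Rightarrow> real \<Rightarrow> real.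
        (\<lambda>(s, t). \<beta>\<^sub>0 s t)
            \<in> borel_measurable (restrict_space (borel \<Otimes>\<^sub>M borel) ({0<..} \<times> levels \<nu> w)) \<longrightarrow>
        (\<forall>s>0. \<forall>t \<in> levels \<nu> w. \<beta>\<^sub>0 s t \<in> {0..1/4}) \<longrightarrow>
        (AE t in lborel. t \<in> levels \<nu> w \<longrightarrow>
            weak_poincare (level_uniform_on \<nu> w t) (H t) (\<lambda>s. \<beta>\<^sub>0 s t)) \<longrightarrow>
        antimono_on {0<..} (averaged_rate \<nu> w \<beta>\<^sub>0) \<and>
        (averaged_rate \<nu> w \<beta>\<^sub>0 \<longlongrightarrow> 0) at_top \<and>
        (\<forall>s>0. \<forall>f \<in> L2_0 (target_measure \<nu> w).
           ereal (dirichlet_form (target_measure \<nu> w) (ideal_slice \<nu> w) f)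
             \<le> ereal (s * dirichlet_form (target_measure \<nu> w) (hybrid_slice \<nu> w H) f)
               + ereal (averaged_rate \<nu> w \<beta>\<^sub>0 s) * (osc_norm (target_measure \<nu> w) f)\<^sup>2))"
proof (intro conjI ballI allI impI, goal_cases)
  interpret sigma_finite_measure \<nu> by fact
  interpret slice_kernel \<nu> w H
    by unfold_locales (use assms in auto)
  \<comment> \<open>Case 1 is part (i). Cases 2 to 4 are the monotonicity, the limit and the
    inequality of part (ii), each with \<open>slice_rate\<close> instantiated from the premises on
    \<open>\<beta>\<^sub>0\<close>.\<close>
  {
    case (1 f)
    then show ?case
      using assms(9) by (intro dirichlet_hybrid_le_ideal) (auto simp: L2_0_def)
  next
    case (2 \<beta>\<^sub>0)
    then interpret slice_rate \<nu> w H \<beta>\<^sub>0 by unfold_locales auto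
    show ?case by (rule antimono_averaged_rate)
  next
    case (3 \<beta>\<^sub>0)
    then interpret slice_rate \<nu> w H \<beta>\<^sub>0 by unfold_locales auto
    show ?case by (rule averaged_rate_tendsto)
  next
    case (4 \<beta>\<^sub>0 s f)
    then interpret slice_rate \<nu> w H \<beta>\<^sub>0 by unfold_locales auto
    show ?case using 4 by (intro dirichlet_ideal_le_ereal) (auto simp: L2_0_def)
  }
qed

end
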